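(* Consider the $2$-dimensional pre-Poisson algebras $P_{01},\dots,P_{04}$, $P_{05}^{\alpha}$, $P_{06}^{\alpha}$, $P_{07}$, $P_{08}$, $P_{09}^{\alpha}$, $P_{10}$ ($\alpha\in\mathbb C$) and the zero algebra $\mathbb C^8$ (both products zero), as defined in the context. Their orbits have the following dimensions: $4$ for $P_{07},P_{08},P_{10}$; $3$ for $P_{01},P_{02},P_{04}$, $P_{05}^{\alpha}$ with $\alpha\ne1$, $P_{06}^{\alpha}$ with $\alpha\neq0$; $2$ for $P_{03}$, $P_{05}^{1}$, $P_{06}^{0}$, $P_{09}^{\alpha}$; $0$ for $\mathbb C^8$. For two algebras $T,T'$ of this list one has $T\to T'$ if and only if $T\cong T'$ or $T'$ can be reached from $T$ by a chain of the following degenerations (valid for all parameter values subject to the indicated restrictions): $P_{07}\to P_{05}^{0}$; $P_{07}\to P_{06}^{1}$; $P_{08}\to P_{05}^{1/2}$; $P_{08}\to P_{06}^{2}$; $P_{10}\to P_{06}^{1}$; $P_{10}\to P_{09}^{\alpha}$ for every $\alpha$; $P_{01}\to P_{06}^{0}$; $P_{01}\to P_{03}$; $P_{02}\to P_{05}^{1}$; $P_{02}\to P_{03}$; $P_{04}\to P_{03}$; $P_{05}^{\alpha}\to P_{03}$ if $\alpha\neq1$; $P_{06}^{\alpha}\to P_{03}$ if $\alpha\neq0$; $P_{09}^{\alpha}\to\mathbb C^8$; $P_{06}^{0}\to\mathbb C^8$; $P_{05}^{1}\to\mathbb C^8$; $P_{03}\to\mathbb C^8$.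
   Context: A pre-Poisson algebra is a complex vector space with a (left) Zinbiel product $\cdot$, i.e. a bilinear product with $x\cdot(y\cdot z)=(y\cdot x+x\cdot y)\cdot z$, and a (left) pre-Lie product $\circ$, i.e. a bilinear product with $(x\circ y)\circ z-(y\circ x)\circ z=x\circ(y\circ z)-y\circ(x\circ z)$, such that $(x\circ y-y\circ x)\cdot z=x\circ(y\cdot z)-y\cdot(x\circ z)$ and $(x\cdot y+y\cdot x)\circ z=x\cdot(y\circ z)+y\cdot(x\circ z)$. Fix a $2$-dimensional complex vector space $V$ with basis $e_1,e_2$. A $2$-dimensional such algebra is viewed as a pair $(\mu,\mu')\in \mathrm{Bil}(V\times V,V)^2\cong\mathbb C^{16}$ ($\mu$ is $\cdot$, $\mu'$ is $\circ$). $\mathrm{GL}(V)$ acts by $(g*(\mu,\mu'))(x,y)=(g\mu(g^{-1}x,g^{-1}y),\,g\mu'(g^{-1}x,g^{-1}y))$; $O(T)$ is the orbit of a structure representing $T$. We write $T\to T'$ ($T$ degenerates to $T'$) if a structure representing $T'$ lies in the Zariski closure $\overline{O(T)}$. The algebras are (unlisted products are zero; $P_{01}$--$P_{08}$ have $\cdot=0$): $P_{01}: e_1\circ e_1=e_1+e_2,\ e_2\circ e_1=e_2$; $P_{02}: e_1\circ e_1=e_1+e_2,\ e_1\circ e_2=e_2$; $P_{03}: e_1\circ e_1=e_2$; $P_{04}: e_2\circ e_1=e_1$; $P_{05}^{\alpha}: e_1\circ e_1=e_1,\ e_1\circ e_2=\alpha e_2$; $P_{06}^{\alpha}: e_1\circ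 e_1=e_1,\ e_1\circ e_2=\alpha e_2,\ e_2\circ e_1=e_2$; $P_{07}: e_1\circ e_1=e_1,\ e_2\circ e_2=e_2$; $P_{08}: e_1\circ e_1=e_1,\ e_1\circ e_2=2e_2,\ e_2\circ e_1=\frac12 e_1+e_2,\ e_2\circ e_2=e_2$; $P_{09}^{\alpha}: e_1\cdot e_1=e_2,\ e_1\circ e_1=\alpha e_2$; $P_{10}: e_1\cdot e_1=e_2,\ e_1\circ e_1=e_1,\ e_1\circ e_2=e_2,\ e_2\circ e_1=e_2$. *)

theory Defs
  imports "HOL-Analysis.Analysis"
begin

section \<open>Pre-Poisson structures on a two-dimensional complex space\<close>

type_synonym V = "complex ^ 2"
type_synonym product = "V \<Rightarrow> V \<Rightarrow> V"

text \<open>The library predicate \<^const>\<open>bilinear\<close> is real bilinearity, hence this complex version.\<close>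

definition bilinear_map :: "product \<Rightarrow> bool" where
  "bilinear_map \<mu> \<longleftrightarrow>
     (\<forall>x. Vector_Spaces.linear (*s) (*s) (\<lambda>y. \<mu> x y)) \<and>
     (\<forall>y. Vector_Spaces.linear (*s) (*s) (\<lambda>x. \<mu> x y))"

text \<open>In a pair \<open>(\<mu>, \<nu>)\<close> the first component is the Zinbiel product and the second one the
  pre-Lie product.\<close>

definition bil_pairs :: "(product \<times> product) set" where
  "bil_pairs = {(\<mu>, \<nu>). bilinear_map \<mu> \<and> bilinear_map \<nu>}"

definition zinbiel :: "product \<Rightarrow> bool" where
  "zinbiel \<mu> \<longleftrightarrow> (\<forall>x y z. \<mu> x (\<mu> y z) = \<mu> (\<mu> y x + \<mu> x y) z)"

definition pre_lie :: "product \<Rightarrow> bool" where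
  "pre_lie \<nu> \<longleftrightarrow>
     (\<forall>x y z. \<nu> (\<nu> x y) z - \<nu> (\<nu> y x) z = \<nu> x (\<nu> y z) - \<nu> y (\<nu> x z))"

definition pre_poisson :: "product \<times> product \<Rightarrow> bool" where
  "pre_poisson = (\<lambda>(\<mu>, \<nu>).
     (\<mu>, \<nu>) \<in> bil_pairs \<and> zinbiel \<mu> \<and> pre_lie \<nu> \<and>
     (\<forall>x y z. \<mu> (\<nu> x y - \<nu> y x) z = \<nu> x (\<mu> y z) - \<mu> y (\<nu> x z)) \<and>
     (\<forall>x y z. \<nu> (\<mu> x y + \<mu> y x) z = \<mu> x (\<nu> y z) + \<mu> y (\<nu> x z)))"

definition isomorphic_alg :: "product \<times> product \<Rightarrow> product \<times> product \<Rightarrow> bool" where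
  "isomorphic_alg = (\<lambda>(\<mu>, \<nu>) (\<mu>', \<nu>'). \<exists>g :: complex ^ 2 ^ 2. invertible g \<and>
     (\<forall>x y. g *v \<mu> x y = \<mu>' (g *v x) (g *v y)) \<and>
     (\<forall>x y. g *v \<nu> x y = \<nu>' (g *v x) (g *v y)))"

definition act :: "complex ^ 2 ^ 2 \<Rightarrow> product \<times> product \<Rightarrow> product \<times> product" where
  "act g = (\<lambda>(\<mu>, \<nu>).
     (\<lambda>x y. g *v \<mu> (matrix_inv g *v x) (matrix_inv g *v y),
      \<lambda>x y. g *v \<nu> (matrix_inv g *v x) (matrix_inv g *v y)))"

definition orbit :: "product \<times> product \<Rightarrow> (product \<times> product) set" where
  "orbit A = {act g A | g. invertible g}"


section \<open>The Zariski topology and degenerations\<close>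

abbreviation e :: "2 \<Rightarrow> V" where
  "e i \<equiv> axis i 1"

text \<open>Polynomials in the 16 structure constants, as functions on pairs of products.\<close>

inductive polynomial_fun :: "(product \<times> product \<Rightarrow> complex) \<Rightarrow> bool" where
  coord_fst: "polynomial_fun (\<lambda>A. fst A (e i) (e j) $ k)"
| coord_snd: "polynomial_fun (\<lambda>A. snd A (e i) (e j) $ k)"
| const: "polynomial_fun (\<lambda>A. c)"
| add: "polynomial_fun p \<Longrightarrow> polynomial_fun q \<Longrightarrow> polynomial_fun (\<lambda>A. p A + q A)"
| mult: "polynomial_fun p \<Longrightarrow> polynomial_fun q \<Longrightarrow> polynomial_fun (\<lambda>A. p A * q A)"

definition zero_locus :: "(product \<times> product \<Rightarrow> complex) set \<Rightarrow> (product \<times> product) set" where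
  "zero_locus F = {A \<in> bil_pairs. \<forall>p\<in>F. p A = 0}"

definition algebraic_set :: "(product \<times> product) set \<Rightarrow> bool" where
  "algebraic_set Z \<longleftrightarrow> (\<exists>F. (\<forall>p\<in>F. polynomial_fun p) \<and> Z = zero_locus F)"

definition zariski :: "(product \<times> product) topology" where
  "zariski = topology (\<lambda>U. U \<subseteq> bil_pairs \<and> algebraic_set (bil_pairs - U))"

lemma algebraic_set_subset: "algebraic_set Z \<Longrightarrow> Z \<subseteq> bil_pairs"
  by (auto simp: algebraic_set_def zero_locus_def)

lemma algebraic_set_empty: "algebraic_set {}"
  unfolding algebraic_set_def zero_locus_def
  by (rule exI[of _ "{\<lambda>_. 1}"]) (auto intro: polynomial_fun.const)

lemma algebraic_set_Un:
  assumes "algebraic_set Y" "algebraic_set Z"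
  shows "algebraic_set (Y \<union> Z)"
proof -
  obtain F G where F: "\<forall>p\<in>F. polynomial_fun p" "Y = zero_locus F"
    and G: "\<forall>p\<in>G. polynomial_fun p" "Z = zero_locus G"
    using assms unfolding algebraic_set_def by blast
  define H where "H = {\<lambda>A. p A * q A | p q. p \<in> F \<and> q \<in> G}"
  have "\<forall>p\<in>H. polynomial_fun p"
    using F(1) G(1) by (auto simp: H_def intro: polynomial_fun.mult)
  moreover have "Y \<union> Z = zero_locus H"
  proof
    show "Y \<union> Z \<subseteq> zero_locus H"
      unfolding F(2) G(2) zero_locus_def H_def by auto
    show "zero_locus H \<subseteq> Y \<union> Z"
    proof
      fix A assume A: "A \<in> zero_locus H"
      have "p A * q A = 0" if "p \<in> F" "q \<in> G" for p q
      proof -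
        have "(\<lambda>A. p A * q A) \<in> H" using that unfolding H_def by blast
        then show ?thesis using A unfolding zero_locus_def by fastforce
      qed
      then have "(\<forall>p\<in>F. p A = 0) \<or> (\<forall>q\<in>G. q A = 0)" by auto
      then show "A \<in> Y \<union> Z" using A unfolding F(2) G(2) zero_locus_def by auto
    qed
  qed
  ultimately show ?thesis unfolding algebraic_set_def by blast
qed

lemma algebraic_set_Inter:
  assumes "\<And>Z. Z \<in> \<Z> \<Longrightarrow> algebraic_set Z"
  shows "algebraic_set (bil_pairs \<inter> \<Inter>\<Z>)"
proof -
  obtain F where F: "\<And>Z. Z \<in> \<Z> \<Longrightarrow> (\<forall>p\<in>F Z. polynomial_fun p) \<and> Z = zero_locus (F Z)"
    using assms unfolding algebraic_set_def by metis
  have "A \<in> bil_pairs \<inter> \<Inter>\<Z> \<longleftrightarrow> A \<in> zero_locus (\<Union>(F ` \<Z>))" for A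
  proof -
    have "A \<in> Z \<longleftrightarrow> A \<in> bil_pairs \<and> (\<forall>p\<in>F Z. p A = 0)" if "Z \<in> \<Z>" for Z
      using F[OF that] unfolding zero_locus_def by blast
    then show ?thesis unfolding zero_locus_def by auto
  qed
  then have "bil_pairs \<inter> \<Inter>\<Z> = zero_locus (\<Union>(F ` \<Z>))" by blast
  moreover have "\<forall>p \<in> \<Union>(F ` \<Z>). polynomial_fun p" using F by blast
  ultimately show ?thesis unfolding algebraic_set_def by blast
qed

lemma istopology_zariski: "istopology (\<lambda>U. U \<subseteq> bil_pairs \<and> algebraic_set (bil_pairs - U))"
  unfolding istopology_def
proof (intro conjI allI impI)
  fix S T
  assume S: "S \<subseteq> bil_pairs \<and> algebraic_set (bil_pairs - S)"
    and T: "T \<subseteq> bil_pairs \<and> algebraic_set (bil_pairs - T)"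
  show "S \<inter> T \<subseteq> bil_pairs" using S by blast
  have "bil_pairs - S \<inter> T = (bil_pairs - S) \<union> (bil_pairs - T)" by blast
  then show "algebraic_set (bil_pairs - S \<inter> T)" using S T algebraic_set_Un by simp
next
  fix \<K>
  assume K: "\<forall>U\<in>\<K>. U \<subseteq> bil_pairs \<and> algebraic_set (bil_pairs - U)"
  show "\<Union>\<K> \<subseteq> bil_pairs" using K by blast
  have "algebraic_set (bil_pairs \<inter> \<Inter>((\<lambda>U. bil_pairs - U) ` \<K>))"
    by (rule algebraic_set_Inter) (use K in blast)
  moreover have "bil_pairs - \<Union>\<K> = bil_pairs \<inter> \<Inter>((\<lambda>U. bil_pairs - U) ` \<K>)"
    by blast
  ultimately show "algebraic_set (bil_pairs - \<Union>\<K>)" by (simp only:)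
qed

lemma openin_zariski:
  "openin zariski U \<longleftrightarrow> U \<subseteq> bil_pairs \<and> algebraic_set (bil_pairs - U)"
  unfolding zariski_def by (simp add: topology_inverse'[OF istopology_zariski])

lemma topspace_zariski: "topspace zariski = bil_pairs"
  unfolding topspace_def openin_zariski using algebraic_set_empty by auto

lemma closedin_zariski: "closedin zariski Z \<longleftrightarrow> algebraic_set Z"
  unfolding closedin_def topspace_zariski openin_zariski
  using algebraic_set_subset by (auto simp: double_diff)

definition degenerates :: "product \<times> product \<Rightarrow> product \<times> product \<Rightarrow> bool" where
  "degenerates A B \<longleftrightarrow> (\<exists>B'. isomorphic_alg B B' \<and> B' \<in> zariski closure_of orbit A)"


section \<open>Dimension\<close>

definition irreducible_in :: "'a topology \<Rightarrow> 'a set \<Rightarrow> bool" where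
  "irreducible_in X S \<longleftrightarrow> S \<subseteq> topspace X \<and> S \<noteq> {} \<and>
     (\<forall>Y Z. closedin X Y \<and> closedin X Z \<and> S \<subseteq> Y \<union> Z \<longrightarrow> S \<subseteq> Y \<or> S \<subseteq> Z)"

text \<open>The Krull dimension of a topological space: the supremum of the lengths \<open>n\<close> of strict chains
  \<open>C 0 \<subset> \<dots> \<subset> C n\<close> of irreducible closed subsets. (The empty space gets the value \<open>0\<close>
  here; orbits are never empty.)\<close>

definition krull_dim :: "'a topology \<Rightarrow> enat" where
  "krull_dim X = Sup {enat n | n. \<exists>C :: nat \<Rightarrow> 'a set.
     (\<forall>i\<le>n. closedin X (C i) \<and> irreducible_in X (C i)) \<and> (\<forall>i<n. C i \<subset> C (Suc i))}"

definition orbit_dim :: "product \<times> product \<Rightarrow> enat" where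
  "orbit_dim A = krull_dim (subtopology zariski (orbit A))"


section \<open>The list of algebras\<close>

text \<open>The bilinear product with \<open>e\<^sub>1e\<^sub>1 = a\<close>, \<open>e\<^sub>1e\<^sub>2 = b\<close>, \<open>e\<^sub>2e\<^sub>1 = c\<close>, \<open>e\<^sub>2e\<^sub>2 = d\<close>.\<close>

definition table :: "V \<Rightarrow> V \<Rightarrow> V \<Rightarrow> V \<Rightarrow> product" where
  "table a b c d = (\<lambda>x y. (x $ 1 * y $ 1) *s a + (x $ 1 * y $ 2) *s b +
                         (x $ 2 * y $ 1) *s c + (x $ 2 * y $ 2) *s d)"

datatype label = P01 | P02 | P03 | P04 | P05 complex | P06 complex | P07 | P08
  | P09 complex | P10 | C8

text \<open>\<open>C8\<close> is the algebra with zero products.\<close>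

fun algebra_of :: "label \<Rightarrow> product \<times> product" where
  "algebra_of P01 = (table 0 0 0 0, table (e 1 + e 2) 0 (e 2) 0)"
| "algebra_of P02 = (table 0 0 0 0, table (e 1 + e 2) (e 2) 0 0)"
| "algebra_of P03 = (table 0 0 0 0, table (e 2) 0 0 0)"
| "algebra_of P04 = (table 0 0 0 0, table 0 0 (e 1) 0)"
| "algebra_of (P05 \<alpha>) = (table 0 0 0 0, table (e 1) (\<alpha> *s e 2) 0 0)"
| "algebra_of (P06 \<alpha>) = (table 0 0 0 0, table (e 1) (\<alpha> *s e 2) (e 2) 0)"
| "algebra_of P07 = (table 0 0 0 0, table (e 1) 0 0 (e 2))"
| "algebra_of P08 = (table 0 0 0 0, table (e 1) (2 *s e 2) ((1/2) *s e 1 + e 2) (e 2))"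
| "algebra_of (P09 \<alpha>) = (table (e 2) 0 0 0, table (\<alpha> *s e 2) 0 0 0)"
| "algebra_of P10 = (table (e 2) 0 0 0, table (e 1) (e 2) (e 2) 0)"
| "algebra_of C8 = (table 0 0 0 0, table 0 0 0 0)"

lemma bilinear_map_table: "bilinear_map (table a b c d)"
proof -
  have *: "Vector_Spaces.linear (*s) (*s) f \<longleftrightarrow>
      (\<forall>x y. f (x + y) = f x + f y) \<and> (\<forall>c x. f (c *s x) = c *s f x)" for f :: "V \<Rightarrow> V"
    by (simp add: Vector_Spaces.linear_iff vec.vector_space_axioms)
  show ?thesis
    unfolding bilinear_map_def table_def *
    by (simp add: vec_eq_iff distrib_left distrib_right mult.assoc mult.left_commute)
qed

lemma table_nth:
  "table a b c d x y $ k = x $ 1 * y $ 1 * a $ k + x $ 1 * y $ 2 * b $ k +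
     x $ 2 * y $ 1 * c $ k + x $ 2 * y $ 2 * d $ k"
  by (simp add: table_def)

lemma pre_poisson_algebra_of: "pre_poisson (algebra_of T)"
proof -
  have e: "e 1 $ 1 = 1" "e 1 $ 2 = 0" "e 2 $ 1 = 0" "e 2 $ 2 = 1"
    by (simp_all add: axis_def)
  show ?thesis
    by (cases T)
      (simp_all add: pre_poisson_def bil_pairs_def bilinear_map_table zinbiel_def pre_lie_def
        vec_eq_iff forall_2 table_nth e, (simp_all add: algebra_simps)?,
        (simp_all add: field_simps)?)
qed

inductive basic_degeneration :: "label \<Rightarrow> label \<Rightarrow> bool" where
  "basic_degeneration P07 (P05 0)"
| "basic_degeneration P07 (P06 1)"
| "basic_degeneration P08 (P05 (1/2))"
| "basic_degeneration P08 (P06 2)"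
| "basic_degeneration P10 (P06 1)"
| "basic_degeneration P10 (P09 \<alpha>)"
| "basic_degeneration P01 (P06 0)"
| "basic_degeneration P01 P03"
| "basic_degeneration P02 (P05 1)"
| "basic_degeneration P02 P03"
| "basic_degeneration P04 P03"
| "\<alpha> \<noteq> 1 \<Longrightarrow> basic_degeneration (P05 \<alpha>) P03"
| "\<alpha> \<noteq> 0 \<Longrightarrow> basic_degeneration (P06 \<alpha>) P03"
| "basic_degeneration (P09 \<alpha>) C8"
| "basic_degeneration (P06 0) C8"
| "basic_degeneration (P05 1) C8"
| "basic_degeneration P03 C8"

end

theory Submission
  imports Defs
begin

text \<open>Dimensions. If \<open>C 0 \<subset> \<dots> \<subset> C m\<close> are irreducible and \<open>f i\<close> vanishes on \<open>C i\<close> but not on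
  \<open>C (Suc i)\<close>, then \<open>f 0, \<dots>, f (m - 1)\<close> are algebraically independent on \<open>C m\<close>: in a relation, set the
  last variable to zero by restricting to \<open>C (m - 1)\<close>, then divide by it. On the other hand, right
  multiplication by the stabilizer normalises a matrix into one of two \<open>d\<close>-dimensional affine
  families of matrices, and \<open>d + 1\<close> polynomial functions are dependent on each of the two families,
  because there are more monomials in them than points of a grid on which a polynomial of the same
  degree in \<open>d\<close> parameters is determined. Conversely, nested affine spaces of matrices give chains of
  irreducible subsets of the orbit.

  Degenerations. An explicit line of structures, isomorphic to the source for nonzero parameter,
  realises each basic degeneration. The others are excluded by closed conditions relating the traces
  of the left multiplications and the traces and determinants of the right multiplications of \<open>\<circ>\<close>, or
  relating \<open>\<cdot>\<close> and \<open>\<circ>\<close> directly.\<close>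

section \<open>Polynomial functions and prime sets\<close>

text \<open>The Krull dimension refers to arbitrary chains of irreducible closed sets, so the upper
  bound must work for a chain about which nothing else is known. Hence dependence is proved for
  every choice of functions, and the counting never sees the chain. Irreducibility enters as a
  cancellation law. Two families of matrices are needed because normalising a matrix divides by an
  entry that may vanish; irreducibility then selects one of the two relations.

  Among the obstructions, the traces of left and right multiplications fix the parameters:
  \<open>tr L = (1 + \<alpha>) tr R\<close> in \<open>P05\<close>,
  \<open>2 tr L = (1 + \<alpha>) tr R\<close> in \<open>P06\<close>. Determinants separate the two
  families: \<open>det R\<close> is 0 in the first and a quarter of \<open>(tr R)^2\<close> in the
  second. What these leave undecided is whether \<open>P05 1\<close> reaches \<open>P02\<close> or
  \<open>P03\<close> and \<open>P06 0\<close> reaches \<open>P01\<close> or \<open>P03\<close>;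
  there the product is \<open>\<phi>(x) y\<close> or \<open>\<phi>(y) x\<close> with a linear form
  \<open>\<phi>\<close>, so each square \<open>x \<circ> x\<close> is a multiple of
  \<open>x\<close>.\<close>

lemma polynomial_fun_sum:
  "(\<And>i. i \<in> I \<Longrightarrow> polynomial_fun (p i)) \<Longrightarrow> polynomial_fun (\<lambda>A. \<Sum>i\<in>I. p i A)"
  by (induction I rule: infinite_finite_induct) (auto intro: polynomial_fun.intros)

lemma polynomial_fun_power: "polynomial_fun p \<Longrightarrow> polynomial_fun (\<lambda>A. p A ^ n)"
  by (induction n) (auto intro: polynomial_fun.intros)

lemma polynomial_fun_uminus: "polynomial_fun p \<Longrightarrow> polynomial_fun (\<lambda>A. - p A)"
  using polynomial_fun.mult[OF polynomial_fun.const[of "-1"], of p] by simp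

lemma polynomial_fun_diff:
  "polynomial_fun p \<Longrightarrow> polynomial_fun q \<Longrightarrow> polynomial_fun (\<lambda>A. p A - q A)"
  using polynomial_fun.add[OF _ polynomial_fun_uminus, of p q] by simp

lemmas polynomial_fun_intros =
  polynomial_fun.intros polynomial_fun_sum polynomial_fun_power polynomial_fun_uminus
  polynomial_fun_diff

text \<open>Primality of the ideal of polynomial functions vanishing on \<open>S\<close>. No
  topology enters, so \<open>S\<close> need not be closed.\<close>

definition prime_set :: "(product \<times> product) set \<Rightarrow> bool" where
  "prime_set S \<longleftrightarrow> S \<noteq> {} \<and>
     (\<forall>p q. polynomial_fun p \<longrightarrow> polynomial_fun q \<longrightarrow> (\<forall>A\<in>S. p A * q A = 0) \<longrightarrow>
        (\<forall>A\<in>S. p A = 0) \<or> (\<forall>A\<in>S. q A = 0))"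

lemma closedin_zero_locus: "(\<And>p. p \<in> F \<Longrightarrow> polynomial_fun p) \<Longrightarrow> closedin zariski (zero_locus F)"
  unfolding closedin_zariski algebraic_set_def by blast

text \<open>If \<open>S\<close> lies in neither of two closed sets, some equation of each fails on
  \<open>S\<close>; when \<open>S\<close> lies in the union, the product of these two equations
  vanishes on \<open>S\<close>. So pairs of single polynomials suffice to test
  irreducibility.\<close>

lemma irreducible_in_iff_prime_set:
  assumes "X \<subseteq> bil_pairs"
  shows "irreducible_in (subtopology zariski X) S \<longleftrightarrow> S \<subseteq> X \<and> prime_set S"
proof
  assume irr: "irreducible_in (subtopology zariski X) S"
  have SX: "S \<subseteq> X" "S \<noteq> {}"
    using irr by (auto simp: irreducible_in_def)
  have "(\<forall>A\<in>S. p A = 0) \<or> (\<forall>A\<in>S. q A = 0)"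
    if pq: "polynomial_fun p" "polynomial_fun q" "\<forall>A\<in>S. p A * q A = 0" for p q
  proof -
    let ?Y = "zero_locus {p} \<inter> X" and ?Z = "zero_locus {q} \<inter> X"
    have "closedin (subtopology zariski X) ?Y" "closedin (subtopology zariski X) ?Z"
      unfolding closedin_subtopology using closedin_zero_locus[of "{p}"] closedin_zero_locus[of "{q}"] pq
      by blast+
    moreover have "S \<subseteq> ?Y \<union> ?Z"
      using SX assms pq(3) by (auto simp: zero_locus_def)
    ultimately have "S \<subseteq> ?Y \<or> S \<subseteq> ?Z"
      using irr unfolding irreducible_in_def by blast
    then show ?thesis by (auto simp: zero_locus_def)
  qed
  then show "S \<subseteq> X \<and> prime_set S"
    using SX by (auto simp: prime_set_def)
next
  assume S: "S \<subseteq> X \<and> prime_set S"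
  have "S \<subseteq> Y \<or> S \<subseteq> Z"
    if YZ: "closedin (subtopology zariski X) Y" "closedin (subtopology zariski X) Z" "S \<subseteq> Y \<union> Z" for Y Z
  proof (rule ccontr)
    assume neg: "\<not> (S \<subseteq> Y \<or> S \<subseteq> Z)"
    obtain F G where F: "\<forall>p\<in>F. polynomial_fun p" "Y = zero_locus F \<inter> X"
      and G: "\<forall>p\<in>G. polynomial_fun p" "Z = zero_locus G \<inter> X"
      using YZ unfolding closedin_subtopology closedin_zariski algebraic_set_def by blast
    obtain p B where p: "p \<in> F" "B \<in> S" "p B \<noteq> 0"
      using neg S assms unfolding F zero_locus_def by blast
    obtain q B' where q: "q \<in> G" "B' \<in> S" "q B' \<noteq> 0"
      using neg S assms unfolding G zero_locus_def by blast
    have "\<forall>A\<in>S. p A * q A = 0"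
      using YZ(3) p(1) q(1) unfolding F G zero_locus_def by auto
    then show False
      using S p q F G unfolding prime_set_def by blast
  qed
  then show "irreducible_in (subtopology zariski X) S"
    using S assms by (auto simp: irreducible_in_def topspace_subtopology topspace_zariski prime_set_def)
qed

text \<open>Turns membership in a closure into a statement on polynomials; existence and exclusion
  of degenerations both go through it.\<close>

lemma in_closure_of_zariski:
  assumes "S \<subseteq> bil_pairs"
  shows "B \<in> zariski closure_of S \<longleftrightarrow>
    B \<in> bil_pairs \<and> (\<forall>p. polynomial_fun p \<longrightarrow> (\<forall>A\<in>S. p A = 0) \<longrightarrow> p B = 0)"
proof -
  let ?F = "{p. polynomial_fun p \<and> (\<forall>A\<in>S. p A = 0)}"
  have cl: "closedin zariski (zero_locus ?F)"
    by (rule closedin_zero_locus) auto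
  have "zariski closure_of S = zero_locus ?F"
  proof
    show "zariski closure_of S \<subseteq> zero_locus ?F"
      by (rule closure_of_minimal[OF _ cl]) (use assms in \<open>auto simp: zero_locus_def\<close>)
    show "zero_locus ?F \<subseteq> zariski closure_of S"
    proof (rule closure_of_unique[THEN equalityD2, OF _ cl])
      show "S \<subseteq> zero_locus ?F" using assms by (auto simp: zero_locus_def)
      fix T assume "S \<subseteq> T" "closedin zariski T"
      then show "zero_locus ?F \<subseteq> T"
        unfolding closedin_zariski algebraic_set_def by (fastforce simp: zero_locus_def)
    qed
  qed
  then show ?thesis by (auto simp: zero_locus_def)
qed

text \<open>A polynomial function vanishing on \<open>S\<close> also vanishes on the closure, so
  both sets have the same vanishing ideal.\<close>

lemma prime_set_closure:
  assumes "S \<subseteq> X" "X \<subseteq> bil_pairs" "prime_set S"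
  shows "prime_set (zariski closure_of S \<inter> X)"
proof -
  have sub: "S \<subseteq> zariski closure_of S \<inter> X"
    using assms closure_of_subset[of S zariski] unfolding topspace_zariski by blast
  have iff: "(\<forall>A \<in> zariski closure_of S \<inter> X. p A = 0) \<longleftrightarrow> (\<forall>A\<in>S. p A = 0)"
    if "polynomial_fun p" for p
    using sub assms in_closure_of_zariski[of S] that by blast
  show ?thesis
    unfolding prime_set_def
  proof (intro conjI allI impI)
    show "zariski closure_of S \<inter> X \<noteq> {}"
      using assms(3) sub by (auto simp: prime_set_def)
    fix p q assume pq: "polynomial_fun p" "polynomial_fun q"
      "\<forall>A \<in> zariski closure_of S \<inter> X. p A * q A = 0"
    then have "\<forall>A\<in>S. p A * q A = 0" using sub by blast
    then show "(\<forall>A \<in> zariski closure_of S \<inter> X. p A = 0) \<or> (\<forall>A \<in> zariski closure_of S \<inter> X. q A = 0)"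
      unfolding iff[OF pq(1)] iff[OF pq(2)] using assms(3) pq(1,2) unfolding prime_set_def by blast
  qed
qed

text \<open>The \<open>T i\<close> need not be closed. Their closures in \<open>X\<close> form the
  chain, and the inclusions stay strict because \<open>p\<close> vanishes on the closure of
  \<open>T i\<close> too.\<close>

lemma krull_dim_ge:
  assumes X: "X \<subseteq> bil_pairs"
    and T: "\<And>i. i \<le> d \<Longrightarrow> prime_set (T i) \<and> T i \<subseteq> X" "\<And>i. i < d \<Longrightarrow> T i \<subseteq> T (Suc i)"
    and p: "\<And>i. i < d \<Longrightarrow> \<exists>p. polynomial_fun p \<and> (\<forall>A\<in>T i. p A = 0) \<and> (\<exists>A\<in>T (Suc i). p A \<noteq> 0)"
  shows "enat d \<le> krull_dim (subtopology zariski X)"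
proof -
  define C where "C i = zariski closure_of T i \<inter> X" for i
  have "closedin (subtopology zariski X) (C i) \<and> irreducible_in (subtopology zariski X) (C i)"
    if "i \<le> d" for i
    using prime_set_closure[of "T i" X] T(1)[OF that] X closedin_closure_of[of zariski "T i"]
    unfolding irreducible_in_iff_prime_set[OF X] C_def closedin_subtopology by blast
  moreover have "C i \<subset> C (Suc i)" if i: "i < d" for i
  proof
    show "C i \<subseteq> C (Suc i)"
      unfolding C_def using closure_of_mono[OF T(2)[OF i]] by blast
    obtain p A where p: "polynomial_fun p" "\<forall>A\<in>T i. p A = 0" "A \<in> T (Suc i)" "p A \<noteq> 0"
      using p[OF i] by blast
    have "T i \<subseteq> bil_pairs" "T (Suc i) \<subseteq> bil_pairs"
      using T(1)[of i] T(1)[of "Suc i"] i X by auto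
    then have "A \<in> C (Suc i)" "A \<notin> C i"
      using T(1)[of "Suc i"] i p unfolding C_def
      by (auto simp: in_closure_of_zariski)
    then show "C i \<noteq> C (Suc i)" by blast
  qed
  ultimately show ?thesis
    unfolding krull_dim_def by (intro Sup_upper) blast
qed

section \<open>Algebraic independence along chains\<close>

text \<open>\<open>nested_poly N m c x\<close> is the general polynomial in \<open>x 0, \<dots>, x (m - 1)\<close> of degree at most \<open>N\<close> in
  each variable; its coefficients are indexed by lists, the exponent of \<open>x (m - 1)\<close> coming first.\<close>

fun nested_poly :: "nat \<Rightarrow> nat \<Rightarrow> (nat list \<Rightarrow> complex) \<Rightarrow> (nat \<Rightarrow> complex) \<Rightarrow> complex" where
  "nested_poly N 0 c x = c []"
| "nested_poly N (Suc m) c x = (\<Sum>j\<le>N. x m ^ j * nested_poly N m (\<lambda>a. c (j # a)) x)"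

definition exponents :: "nat \<Rightarrow> nat \<Rightarrow> nat list set" where
  "exponents N m = {a. set a \<subseteq> {..N} \<and> length a = m}"

fun monomial :: "nat list \<Rightarrow> (nat \<Rightarrow> complex) \<Rightarrow> complex" where
  "monomial [] x = 1"
| "monomial (j # a) x = x (length a) ^ j * monomial a x"

lemma finite_exponents: "finite (exponents N m)"
  unfolding exponents_def by (rule finite_lists_length_eq) simp

lemma card_exponents: "card (exponents N m) = Suc N ^ m"
  unfolding exponents_def by (subst card_lists_length_eq) auto

lemma exponents_Suc: "exponents N (Suc m) = (\<lambda>(j, a). j # a) ` ({..N} \<times> exponents N m)"
  by (force simp: exponents_def length_Suc_conv image_iff)

lemma nested_poly_eq_sum: "nested_poly N m c x = (\<Sum>a\<in>exponents N m. c a * monomial a x)"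
proof (induction m arbitrary: c)
  case 0
  have "exponents N 0 = {[]}" by (auto simp: exponents_def)
  then show ?case by simp
next
  case (Suc m)
  have inj: "inj_on (\<lambda>(j, a). j # a) ({..N} \<times> exponents N m)"
    by (auto simp: inj_on_def)
  have len: "length a = m" if "a \<in> exponents N m" for a
    using that by (simp add: exponents_def)
  show ?case
    unfolding exponents_Suc sum.reindex[OF inj]
    by (simp add: sum.cartesian_product Suc sum_distrib_left case_prod_unfold o_def)
      (rule sum.cong, auto simp: len mult.left_commute)
qed

lemma polynomial_fun_nested_poly:
  "(\<And>i. i < m \<Longrightarrow> polynomial_fun (f i)) \<Longrightarrow> polynomial_fun (\<lambda>B. nested_poly N m c (\<lambda>i. f i B))"
  by (induction m arbitrary: c) (auto intro!: polynomial_fun_intros)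

text \<open>The relation is read as a polynomial in the last function \<open>f m\<close> with
  coefficients \<open>F j\<close> in the earlier ones. By induction, vanishing of \<open>F j\<close>
  on the small set \<open>C m\<close> already kills its coefficients, hence \<open>F j\<close>
  vanishes on \<open>C (Suc m)\<close> as well.\<close>

lemma nested_poly_zero_coeffs:
  assumes "\<And>i. i \<le> m \<Longrightarrow> prime_set (C i)"
    and "\<And>i. i < m \<Longrightarrow> C i \<subseteq> C (Suc i)"
    and "\<And>i. i < m \<Longrightarrow> polynomial_fun (f i)"
    and "\<And>i. i < m \<Longrightarrow> \<forall>B\<in>C i. f i B = 0"
    and "\<And>i. i < m \<Longrightarrow> \<exists>B\<in>C (Suc i). f i B \<noteq> 0"
    and "\<forall>B\<in>C m. nested_poly N m c (\<lambda>i. f i B) = 0"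
  shows "\<forall>a\<in>exponents N m. c a = 0"
  using assms
proof (induction m arbitrary: c)
  case 0
  obtain B where "B \<in> C 0" using 0(1)[of 0] unfolding prime_set_def by blast
  then have "c [] = 0" using 0(6) unfolding nested_poly.simps by blast
  then show ?case by (auto simp: exponents_def)
next
  case (Suc m)
  define F where "F j B = nested_poly N m (\<lambda>a. c (j # a)) (\<lambda>i. f i B)" for j B
  have F_poly: "polynomial_fun (F j)" for j
    unfolding F_def by (rule polynomial_fun_nested_poly) (use Suc.prems(3) in auto)
  have F_eq: "\<forall>a\<in>exponents N m. c (j # a) = 0" if "\<forall>B\<in>C m. F j B = 0" for j
    by (rule Suc.IH) (use Suc.prems that in \<open>simp_all add: F_def\<close>)
  have zero: "(\<Sum>j\<le>N. f m B ^ j * F j B) = 0" if "B \<in> C (Suc m)" for B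
    using Suc.prems(6) that by (auto simp: F_def)
  have "j \<le> N \<Longrightarrow> \<forall>a\<in>exponents N m. c (j # a) = 0" for j
  proof (induction j rule: less_induct)
    case (less j)
    \<comment> \<open>What remains of the relation once the terms below \<open>j\<close> are gone
      and \<open>f m ^ j\<close> is split off.\<close>
    define R where "R B = (\<Sum>i\<le>N - j. f m B ^ i * F (i + j) B)" for B
    have R_poly: "polynomial_fun R"
      unfolding R_def by (intro polynomial_fun_intros Suc.prems(3) F_poly) simp
    have "f m B ^ j * R B = 0" if B: "B \<in> C (Suc m)" for B
    proof -
      have F0: "F i B = 0" if "i < j" for i
        using less that unfolding F_def nested_poly_eq_sum by auto
      have "(\<Sum>i\<le>N. f m B ^ i * F i B) = (\<Sum>i\<in>{j..N}. f m B ^ i * F i B)"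
        by (rule sum.mono_neutral_right) (auto simp: F0)
      also have "\<dots> = (\<Sum>i\<le>N - j. f m B ^ (i + j) * F (i + j) B)"
        by (rule sum.reindex_bij_witness[of _ "\<lambda>i. i + j" "\<lambda>i. i - j"]) (use less.prems in auto)
      also have "\<dots> = f m B ^ j * R B"
        unfolding R_def sum_distrib_left by (simp add: power_add mult_ac)
      finally show ?thesis using zero[OF B] by simp
    qed
    moreover have "\<not> (\<forall>B\<in>C (Suc m). f m B ^ j = 0)"
      using Suc.prems(5)[of m] by auto
    \<comment> \<open>\<open>f m ^ j\<close> is not identically zero on the prime set
      \<open>C (Suc m)\<close>, so it cancels.\<close>
    ultimately have R0: "\<forall>B\<in>C (Suc m). R B = 0"
      using Suc.prems(1)[of "Suc m"] polynomial_fun_power[OF Suc.prems(3)[of m], of j] R_poly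
      unfolding prime_set_def by blast
    \<comment> \<open>On \<open>C m\<close> the function \<open>f m\<close> vanishes, and only the
      constant term \<open>F j\<close> of \<open>R\<close> survives.\<close>
    have "F j B = 0" if "B \<in> C m" for B
    proof -
      have "R B = 0" "f m B = 0"
        using R0 Suc.prems(2)[of m] Suc.prems(4)[of m] that by auto
      moreover have "(\<Sum>i\<le>N - j. 0 ^ i * F (i + j) B) = (\<Sum>i\<in>{0}. 0 ^ i * F (i + j) B)"
        by (rule sum.mono_neutral_right) auto
      ultimately show ?thesis unfolding R_def by simp
    qed
    then show ?case using F_eq by blast
  qed
  then show ?case by (auto simp: exponents_Suc)
qed

text \<open>Says that the polynomial functions restricted to \<open>S\<close> have transcendence
  degree below \<open>m\<close>.\<close>

definition algebraically_dependent :: "nat \<Rightarrow> (product \<times> product) set \<Rightarrow> bool" where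
  "algebraically_dependent m S \<longleftrightarrow>
     (\<forall>f. (\<forall>i<m. polynomial_fun (f i)) \<longrightarrow>
        (\<exists>N c. (\<exists>a\<in>exponents N m. c a \<noteq> 0) \<and> (\<forall>B\<in>S. nested_poly N m c (\<lambda>i. f i B) = 0)))"

text \<open>The first \<open>Suc d\<close> steps of a longer chain would give \<open>Suc d\<close>
  functions that are independent on \<open>C (Suc d)\<close>.\<close>

lemma krull_dim_le:
  assumes X: "X \<subseteq> bil_pairs" "X \<subseteq> S \<union> S'"
    and dep: "algebraically_dependent (Suc d) S" "algebraically_dependent (Suc d) S'"
  shows "krull_dim (subtopology zariski X) \<le> enat d"
  unfolding krull_dim_def
proof (rule Sup_least, clarify)
  fix n and C :: "nat \<Rightarrow> (product \<times> product) set"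
  assume C: "\<forall>i\<le>n. closedin (subtopology zariski X) (C i) \<and> irreducible_in (subtopology zariski X) (C i)"
    "\<forall>i<n. C i \<subset> C (Suc i)"
  have "n \<le> d"
  proof (rule ccontr)
    assume "\<not> n \<le> d"
    then have n: "Suc d \<le> n" by simp
    have prime: "prime_set (C i)" "C i \<subseteq> X" if "i \<le> Suc d" for i
      using C(1) that n by (auto simp: irreducible_in_iff_prime_set[OF X(1)])
    have "\<exists>f. polynomial_fun f \<and> (\<forall>B\<in>C i. f B = 0) \<and> (\<exists>B\<in>C (Suc i). f B \<noteq> 0)" if i: "i < Suc d" for i
    proof -
      have "closedin (subtopology zariski X) (C i)" "C i \<subset> C (Suc i)"
        using C i n by auto
      then obtain F B where F: "\<forall>p\<in>F. polynomial_fun p" "C i = zero_locus F \<inter> X"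
        and B: "B \<in> C (Suc i)" "B \<notin> C i"
        unfolding closedin_subtopology closedin_zariski algebraic_set_def by blast
      then have "B \<in> X" using prime(2)[of "Suc i"] i by auto
      then obtain p where "p \<in> F" "p B \<noteq> 0"
        using B(2) X(1) unfolding F(2) zero_locus_def by blast
      then show ?thesis using F B(1) unfolding zero_locus_def by blast
    qed
    then obtain f where f: "\<And>i. i < Suc d \<Longrightarrow> polynomial_fun (f i)"
      "\<And>i. i < Suc d \<Longrightarrow> \<forall>B\<in>C i. f i B = 0" "\<And>i. i < Suc d \<Longrightarrow> \<exists>B\<in>C (Suc i). f i B \<noteq> 0"
      by metis
    have indep: False
      if "\<exists>a\<in>exponents N (Suc d). c a \<noteq> 0" "\<forall>B\<in>C (Suc d). nested_poly N (Suc d) c (\<lambda>i. f i B) = 0" for N c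
    proof -
      have "\<forall>a\<in>exponents N (Suc d). c a = 0"
        by (rule nested_poly_zero_coeffs[of "Suc d" C f]) (use prime C n f that(2) in \<open>simp_all add: psubset_imp_subset\<close>)
      then show False using that(1) by blast
    qed
    obtain N c where c: "\<exists>a\<in>exponents N (Suc d). c a \<noteq> 0" "\<forall>B\<in>S. nested_poly N (Suc d) c (\<lambda>i. f i B) = 0"
      using dep(1) f(1) unfolding algebraically_dependent_def by blast
    obtain N' c' where c': "\<exists>a\<in>exponents N' (Suc d). c' a \<noteq> 0" "\<forall>B\<in>S'. nested_poly N' (Suc d) c' (\<lambda>i. f i B) = 0"
      using dep(2) f(1) unfolding algebraically_dependent_def by blast
    \<comment> \<open>Each point satisfies at least one of the two relations, so their product
      vanishes; primality then yields one relation valid on all of \<open>C (Suc d)\<close>.\<close>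
    have "\<forall>B\<in>C (Suc d). nested_poly N (Suc d) c (\<lambda>i. f i B) * nested_poly N' (Suc d) c' (\<lambda>i. f i B) = 0"
      using prime(2)[of "Suc d"] X(2) c(2) c'(2) by fastforce
    then have "(\<forall>B\<in>C (Suc d). nested_poly N (Suc d) c (\<lambda>i. f i B) = 0) \<or>
        (\<forall>B\<in>C (Suc d). nested_poly N' (Suc d) c' (\<lambda>i. f i B) = 0)"
      using prime(1)[of "Suc d"]
        polynomial_fun_nested_poly[of "Suc d" f N c] polynomial_fun_nested_poly[of "Suc d" f N' c'] f(1)
      unfolding prime_set_def by blast
    then show False using indep c(1) c'(1) by blast
  qed
  then show "enat n \<le> enat d" by simp
qed

section \<open>Counting: more functions than parameters are algebraically dependent\<close>

text \<open>Gaussian elimination: the unknown \<open>i0\<close> is solved from equation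
  \<open>j\<close> and substituted into the others, whose coefficients become
  \<open>w'\<close>.\<close>

lemma homogeneous_system_nontrivial:
  fixes w :: "'i \<Rightarrow> 'j \<Rightarrow> 'a :: field"
  assumes "finite J" "finite I" "card J < card I"
  shows "\<exists>c. (\<exists>i\<in>I. c i \<noteq> 0) \<and> (\<forall>j\<in>J. (\<Sum>i\<in>I. c i * w i j) = 0)"
  using assms
proof (induction J arbitrary: I w rule: finite_induct)
  case empty
  then show ?case by (intro exI[of _ "\<lambda>_. 1"]) (auto simp: card_gt_0_iff)
next
  case (insert j J)
  show ?case
  proof (cases "\<forall>i\<in>I. w i j = 0")
    case True
    obtain c where "\<exists>i\<in>I. c i \<noteq> 0" "\<forall>j\<in>J. (\<Sum>i\<in>I. c i * w i j) = 0"
      using insert.IH[of I w] insert.prems insert.hyps by auto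
    then show ?thesis using True by (intro exI[of _ c]) auto
  next
    case False
    then obtain i0 where i0: "i0 \<in> I" "w i0 j \<noteq> 0" by blast
    define w' where "w' i k = w i k - w i j / w i0 j * w i0 k" for i k
    have "card J < card (I - {i0})"
      using insert.prems insert.hyps i0(1) by simp
    then obtain c where c: "\<exists>i\<in>I - {i0}. c i \<noteq> 0"
      "\<forall>k\<in>J. (\<Sum>i\<in>I - {i0}. c i * w' i k) = 0"
      using insert.IH[of "I - {i0}" w'] insert.prems by auto
    define s where "s = (\<Sum>i\<in>I - {i0}. c i * w i j)"
    define c' where "c' = c(i0 := - s / w i0 j)"
    have sum_c': "(\<Sum>i\<in>I. c' i * w i k) = (\<Sum>i\<in>I - {i0}. c i * w i k) - s / w i0 j * w i0 k" for k
      using insert.prems i0(1) by (subst sum.remove[of _ i0]) (auto simp: c'_def)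
    have "(\<Sum>i\<in>I. c' i * w i k) = 0" if "k \<in> J" for k
    proof -
      have "(\<Sum>i\<in>I - {i0}. c i * w' i k)
          = (\<Sum>i\<in>I - {i0}. c i * w i k) - (\<Sum>i\<in>I - {i0}. c i * w i j / w i0 j * w i0 k)"
        by (simp add: w'_def right_diff_distrib sum_subtractf mult.assoc)
      also have "(\<Sum>i\<in>I - {i0}. c i * w i j / w i0 j * w i0 k) = s / w i0 j * w i0 k"
        by (simp add: s_def sum_distrib_right sum_divide_distrib)
      finally show ?thesis using c(2) that sum_c' by simp
    qed
    moreover have "(\<Sum>i\<in>I. c' i * w i j) = 0"
      unfolding sum_c' using i0(2) by (simp add: s_def)
    moreover have "\<exists>i\<in>I. c' i \<noteq> 0"
      using c(1) by (auto simp: c'_def)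
    ultimately show ?thesis by blast
  qed
qed

section \<open>Univariate polynomials of bounded degree\<close>

definition poly_degree_le :: "nat \<Rightarrow> (complex \<Rightarrow> complex) \<Rightarrow> bool" where
  "poly_degree_le D h \<longleftrightarrow> (\<exists>P. degree P \<le> D \<and> h = poly P)"

lemma poly_degree_le_const: "poly_degree_le D (\<lambda>t. c)"
  unfolding poly_degree_le_def by (intro exI[of _ "[:c:]"]) auto

lemma poly_degree_le_linear: "1 \<le> D \<Longrightarrow> poly_degree_le D (\<lambda>t. a + t * b)"
  unfolding poly_degree_le_def by (intro exI[of _ "[:a, b:]"]) auto

lemma poly_degree_le_add:
  "poly_degree_le D h \<Longrightarrow> poly_degree_le D k \<Longrightarrow> poly_degree_le D (\<lambda>t. h t + k t)"
  unfolding poly_degree_le_def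
proof (elim exE conjE)
  fix P Q assume "degree P \<le> D" "h = poly P" "degree Q \<le> D" "k = poly Q"
  then show "\<exists>R. degree R \<le> D \<and> (\<lambda>t. h t + k t) = poly R"
    by (intro exI[of _ "P + Q"]) (auto simp: degree_add_le)
qed

lemma poly_degree_le_mult:
  assumes "poly_degree_le D h" "poly_degree_le E k"
  shows "poly_degree_le (D + E) (\<lambda>t. h t * k t)"
proof -
  obtain P Q where "degree P \<le> D" "h = poly P" "degree Q \<le> E" "k = poly Q"
    using assms unfolding poly_degree_le_def by blast
  then show ?thesis
    unfolding poly_degree_le_def using degree_mult_le[of P Q]
    by (intro exI[of _ "P * Q"]) (auto simp: fun_eq_iff)
qed

lemma poly_degree_le_mono: "poly_degree_le D h \<Longrightarrow> D \<le> E \<Longrightarrow> poly_degree_le E h"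
  unfolding poly_degree_le_def using order_trans by blast

lemma poly_degree_le_zero_on_grid:
  assumes "poly_degree_le D h" "\<And>n. n \<le> D \<Longrightarrow> h (of_nat n) = 0"
  shows "h t = 0"
proof -
  obtain P where P: "degree P \<le> D" "h = poly P"
    using assms(1) unfolding poly_degree_le_def by blast
  have "P = 0"
  proof (rule ccontr)
    assume "P \<noteq> 0"
    have "(of_nat ` {..D} :: complex set) \<subseteq> {t. poly P t = 0}"
      using assms(2) P(2) by auto
    then have "card (of_nat ` {..D} :: complex set) \<le> card {t. poly P t = 0}"
      using poly_roots_finite[OF \<open>P \<noteq> 0\<close>] by (rule card_mono[rotated])
    also have "\<dots> \<le> degree P" by (rule card_poly_roots_bound[OF \<open>P \<noteq> 0\<close>])
    finally show False using P(1) by (simp add: card_image)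
  qed
  then show ?thesis using P(2) by simp
qed

lemma poly_degree_le_finite_zeros:
  assumes "poly_degree_le D h" "h s \<noteq> 0"
  shows "finite {t. h t = 0}"
proof -
  obtain P where P: "degree P \<le> D" "h = poly P"
    using assms(1) unfolding poly_degree_le_def by blast
  then have "P \<noteq> 0" using assms(2) by auto
  then show ?thesis unfolding P(2) by (rule poly_roots_finite)
qed

text \<open>Functions on matrices whose restriction to each affine line is a polynomial of bounded
  degree; this is all that is needed of the notion of a polynomial in the matrix entries.\<close>

definition line :: "complex^2^2 \<Rightarrow> complex^2^2 \<Rightarrow> complex \<Rightarrow> complex^2^2" where
  "line g k t = (\<chi> i j. g $ i $ j + t * k $ i $ j)"

definition line_poly :: "nat \<Rightarrow> (complex^2^2 \<Rightarrow> complex) \<Rightarrow> bool" where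
  "line_poly D h \<longleftrightarrow> (\<forall>g k. poly_degree_le D (\<lambda>t. h (line g k t)))"

lemma line_poly_const: "line_poly D (\<lambda>g. c)"
  by (simp add: line_poly_def poly_degree_le_const)

lemma line_poly_entry: "line_poly 1 (\<lambda>g. g $ i $ j)"
  by (simp add: line_poly_def line_def poly_degree_le_linear)

lemma line_poly_add: "line_poly D h \<Longrightarrow> line_poly D k \<Longrightarrow> line_poly D (\<lambda>g. h g + k g)"
  by (simp add: line_poly_def poly_degree_le_add)

lemma line_poly_mult: "line_poly D h \<Longrightarrow> line_poly E k \<Longrightarrow> line_poly (D + E) (\<lambda>g. h g * k g)"
  by (simp add: line_poly_def poly_degree_le_mult)

lemma line_poly_mult_const: "line_poly D h \<Longrightarrow> line_poly D (\<lambda>g. h g * c)"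
  using line_poly_mult[OF _ line_poly_const[of 0 c], of D h] by simp

lemma line_poly_mono: "line_poly D h \<Longrightarrow> D \<le> E \<Longrightarrow> line_poly E h"
  unfolding line_poly_def using poly_degree_le_mono by blast

lemma line_poly_uminus: "line_poly D h \<Longrightarrow> line_poly D (\<lambda>g. - h g)"
  using line_poly_mult[OF line_poly_const[of 0 "-1"], of D h] by simp

lemma line_poly_diff: "line_poly D h \<Longrightarrow> line_poly D k \<Longrightarrow> line_poly D (\<lambda>g. h g - k g)"
  using line_poly_add[OF _ line_poly_uminus, of D h k] by simp

lemma line_poly_power: "line_poly D h \<Longrightarrow> line_poly (n * D) (\<lambda>g. h g ^ n)"
  by (induction n) (auto intro: line_poly_const line_poly_mult)

lemma line_poly_det: "line_poly 2 (\<lambda>g. det g)"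
  unfolding det_2 one_add_one[symmetric]
  by (intro line_poly_diff line_poly_mult line_poly_entry)

section \<open>The action in coordinates\<close>

lemma matrix_vector_mult_2:
  fixes g :: "complex^2^2"
  shows "(g *v x) $ i = g $ i $ 1 * x $ 1 + g $ i $ 2 * x $ 2"
  by (simp add: matrix_vector_mult_def sum_2)

lemma matrix_inv_cancel:
  fixes g :: "complex^2^2"
  assumes "invertible g"
  shows "g ** matrix_inv g = mat 1" "matrix_inv g ** g = mat 1"
    and "g *v (matrix_inv g *v x) = x" "matrix_inv g *v (g *v x) = x"
proof -
  have "g ** matrix_inv g = mat 1 \<and> matrix_inv g ** g = mat 1"
    using assms someI_ex[of "\<lambda>h. g ** h = mat 1 \<and> h ** g = mat 1"]
    unfolding matrix_inv_def invertible_def by blast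
  then show "g ** matrix_inv g = mat 1" "matrix_inv g ** g = mat 1"
    "g *v (matrix_inv g *v x) = x" "matrix_inv g *v (g *v x) = x"
    by (simp_all add: matrix_vector_mul_assoc)
qed

text \<open>Cramer's rule; the point is that \<open>det g\<close> is the only denominator.\<close>

lemma matrix_inv_mult_2:
  fixes g :: "complex^2^2"
  assumes "det g \<noteq> 0"
  shows "(matrix_inv g *v x) $ 1 = (g $ 2 $ 2 * x $ 1 - g $ 1 $ 2 * x $ 2) / det g"
    and "(matrix_inv g *v x) $ 2 = (g $ 1 $ 1 * x $ 2 - g $ 2 $ 1 * x $ 1) / det g"
proof -
  have gx: "g *v (matrix_inv g *v x) = x"
    using assms by (simp add: matrix_inv_cancel invertible_det_nz)
  define y where "y = matrix_inv g *v x"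
  have y: "x $ 1 = g $ 1 $ 1 * y $ 1 + g $ 1 $ 2 * y $ 2" "x $ 2 = g $ 2 $ 1 * y $ 1 + g $ 2 $ 2 * y $ 2"
    using gx unfolding y_def[symmetric] by (simp_all add: vec_eq_iff forall_2 matrix_vector_mult_2)
  have "y $ 1 * det g = g $ 2 $ 2 * x $ 1 - g $ 1 $ 2 * x $ 2" "y $ 2 * det g = g $ 1 $ 1 * x $ 2 - g $ 2 $ 1 * x $ 1"
    unfolding y det_2 by (simp_all add: algebra_simps)
  then show "(matrix_inv g *v x) $ 1 = (g $ 2 $ 2 * x $ 1 - g $ 1 $ 2 * x $ 2) / det g"
    "(matrix_inv g *v x) $ 2 = (g $ 1 $ 1 * x $ 2 - g $ 2 $ 1 * x $ 1) / det g"
    using assms unfolding y_def[symmetric] by (simp_all add: eq_divide_eq)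
qed

lemma e_nth: "e 1 $ 1 = 1" "e 1 $ 2 = 0" "e 2 $ 1 = 0" "e 2 $ 2 = 1"
  by (simp_all add: axis_def)

lemma bilinear_map_eq_table:
  assumes "bilinear_map \<mu>"
  shows "\<mu> = table (\<mu> (e 1) (e 1)) (\<mu> (e 1) (e 2)) (\<mu> (e 2) (e 1)) (\<mu> (e 2) (e 2))"
proof (intro ext)
  fix x y :: V
  have *: "Vector_Spaces.linear (*s) (*s) f \<longleftrightarrow>
      (\<forall>x y. f (x + y) = f x + f y) \<and> (\<forall>c x. f (c *s x) = c *s f x)" for f :: "V \<Rightarrow> V"
    by (simp add: Vector_Spaces.linear_iff vec.vector_space_axioms)
  have lin: "\<mu> (x + y) z = \<mu> x z + \<mu> y z" "\<mu> (c *s x) z = c *s \<mu> x z"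
    "\<mu> z (x + y) = \<mu> z x + \<mu> z y" "\<mu> z (c *s x) = c *s \<mu> z x" for x y z c
    using assms unfolding bilinear_map_def * by auto
  have dec: "x = x $ 1 *s e 1 + x $ 2 *s e 2" for x :: V
    by (simp add: vec_eq_iff forall_2 e_nth)
  have "\<mu> x y = \<mu> (x $ 1 *s e 1 + x $ 2 *s e 2) (y $ 1 *s e 1 + y $ 2 *s e 2)"
    using dec by metis
  also have "\<dots> = table (\<mu> (e 1) (e 1)) (\<mu> (e 1) (e 2)) (\<mu> (e 2) (e 1)) (\<mu> (e 2) (e 2)) x y"
    unfolding lin table_def by (simp add: vec_eq_iff algebra_simps)
  finally show "\<mu> x y = \<dots>" .
qed

lemma bilinear_map_conj:
  assumes "bilinear_map \<mu>"
  shows "bilinear_map (\<lambda>x y. g *v \<mu> (h *v x) (h *v y))"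
proof -
  have *: "Vector_Spaces.linear (*s) (*s) f \<longleftrightarrow>
      (\<forall>x y. f (x + y) = f x + f y) \<and> (\<forall>c x. f (c *s x) = c *s f x)" for f :: "V \<Rightarrow> V"
    by (simp add: Vector_Spaces.linear_iff vec.vector_space_axioms)
  show ?thesis
    using assms unfolding bilinear_map_def *
    by (simp add: matrix_vector_right_distrib vector_scalar_commute)
qed

lemma act_bil_pairs: "A \<in> bil_pairs \<Longrightarrow> act g A \<in> bil_pairs"
  by (auto simp: bil_pairs_def act_def bilinear_map_conj)

lemma orbit_subset_bil_pairs: "A \<in> bil_pairs \<Longrightarrow> orbit A \<subseteq> bil_pairs"
  by (auto simp: orbit_def act_bil_pairs)

lemma algebra_of_bil_pairs: "algebra_of T \<in> bil_pairs"
  using pre_poisson_algebra_of[of T] by (auto simp: pre_poisson_def)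

definition coordinate_of_action :: "product \<Rightarrow> complex^2^2 \<Rightarrow> 2 \<Rightarrow> 2 \<Rightarrow> 2 \<Rightarrow> complex" where
  "coordinate_of_action \<mu> g i j k = (g *v \<mu> (matrix_inv g *v e i) (matrix_inv g *v e j)) $ k"

text \<open>Each of the two inverse matrices contributes one denominator \<open>det g\<close>. The
  numerator is an entry of \<open>g\<close> times two factors linear in \<open>g\<close>, hence
  degree 3.\<close>

lemma coordinate_of_action_line_poly:
  assumes "bilinear_map \<mu>"
  shows "\<exists>H. line_poly 3 H \<and> (\<forall>g. det g \<noteq> 0 \<longrightarrow> coordinate_of_action \<mu> g i j k * det g ^ 2 = H g)"
proof -
  define u where "u g x = ((g $ 2 $ 2 * x $ 1 - g $ 1 $ 2 * x $ 2) :: complex)" for g :: "complex^2^2" and x :: V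
  define v where "v g x = ((g $ 1 $ 1 * x $ 2 - g $ 2 $ 1 * x $ 1) :: complex)" for g :: "complex^2^2" and x :: V
  have uv: "line_poly 1 (\<lambda>g. u g x)" "line_poly 1 (\<lambda>g. v g x)" for x
    unfolding u_def v_def
    by (intro line_poly_diff line_poly_mult_const line_poly_entry)+
  obtain a b c d where \<mu>: "\<mu> = table a b c d"
    using bilinear_map_eq_table[OF assms] by metis
  define N where "N g l = u g (e i) * u g (e j) * a $ l + u g (e i) * v g (e j) * b $ l
    + v g (e i) * u g (e j) * c $ l + v g (e i) * v g (e j) * d $ l" for g l
  have N: "line_poly 2 (\<lambda>g. N g l)" for l
    unfolding N_def one_add_one[symmetric]
    by (intro line_poly_add line_poly_mult_const line_poly_mult uv)
  have "line_poly 3 (\<lambda>g. g $ k $ 1 * N g 1 + g $ k $ 2 * N g 2)"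
    by (intro line_poly_add line_poly_mono[OF line_poly_mult[OF line_poly_entry N]]) simp_all
  moreover have "coordinate_of_action \<mu> g i j k * det g ^ 2 = g $ k $ 1 * N g 1 + g $ k $ 2 * N g 2"
    if "det g \<noteq> 0" for g
    unfolding coordinate_of_action_def matrix_vector_mult_2[of g] \<mu> table_nth matrix_inv_mult_2[OF that]
      N_def u_def[symmetric] v_def[symmetric]
    using that by (simp add: power2_eq_square add_divide_distrib[symmetric] field_simps)
  ultimately show ?thesis by blast
qed

text \<open>\<open>act g A\<close> is only rational in \<open>g\<close>, with powers of
  \<open>det g\<close> as denominators. The identity is asserted off \<open>det g = 0\<close>, where
  \<open>matrix_inv\<close> is a genuine inverse.\<close>

lemma polynomial_fun_act_line_poly:
  assumes "A \<in> bil_pairs" "polynomial_fun p"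
  shows "\<exists>n D H. line_poly D H \<and> (\<forall>g. det g \<noteq> 0 \<longrightarrow> p (act g A) * det g ^ n = H g)"
  using assms(2)
proof induction
  case (coord_fst i j k)
  show ?case
    using coordinate_of_action_line_poly[of "fst A" i j k] assms(1)
    by (auto simp: act_def coordinate_of_action_def bil_pairs_def case_prod_unfold)
next
  case (coord_snd i j k)
  show ?case
    using coordinate_of_action_line_poly[of "snd A" i j k] assms(1)
    by (auto simp: act_def coordinate_of_action_def bil_pairs_def case_prod_unfold)
next
  case (const c)
  show ?case
    by (rule exI[of _ 0], rule exI[of _ 0], rule exI[of _ "\<lambda>_. c"]) (simp add: line_poly_const)
next
  case (add p q)
  obtain n D H m E K where *: "line_poly D H" "\<And>g. det g \<noteq> 0 \<Longrightarrow> p (act g A) * det g ^ n = H g"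
    "line_poly E K" "\<And>g. det g \<noteq> 0 \<Longrightarrow> q (act g A) * det g ^ m = K g"
    using add.IH by metis
  have "line_poly (D + m * 2 + (E + n * 2)) (\<lambda>g. H g * det g ^ m + K g * det g ^ n)"
    by (rule line_poly_add; rule line_poly_mono[OF line_poly_mult[OF _ line_poly_power[OF line_poly_det]]])
      (use * in auto)
  moreover have "(p (act g A) + q (act g A)) * det g ^ (n + m) = H g * det g ^ m + K g * det g ^ n"
    if "det g \<noteq> 0" for g
    using *(2,4)[OF that, symmetric] by (simp add: power_add algebra_simps)
  ultimately show ?case by blast
next
  case (mult p q)
  obtain n D H m E K where *: "line_poly D H" "\<And>g. det g \<noteq> 0 \<Longrightarrow> p (act g A) * det g ^ n = H g"
    "line_poly E K" "\<And>g. det g \<noteq> 0 \<Longrightarrow> q (act g A) * det g ^ m = K g"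
    using mult.IH by metis
  have "(p (act g A) * q (act g A)) * det g ^ (n + m) = H g * K g" if "det g \<noteq> 0" for g
    using *(2,4)[OF that, symmetric] by (simp add: power_add algebra_simps)
  then show ?case using line_poly_mult[OF *(1,3)] by blast
qed

section \<open>Dimension bounds for orbits\<close>

text \<open>Only the degree in each variable separately is bounded: coordinates leave the grid one
  at a time, each time by the univariate root bound.\<close>

lemma zero_on_grid_imp_zero:
  fixes h :: "(nat \<Rightarrow> complex) \<Rightarrow> complex"
  assumes h: "\<And>x i. poly_degree_le K (\<lambda>t. h (x(i := t)))"
    and grid: "\<And>y. y \<in> {..<d} \<rightarrow>\<^sub>E {..K} \<Longrightarrow> h (\<lambda>i. if i < d then of_nat (y i) else 0) = 0"
    and x: "\<And>i. d \<le> i \<Longrightarrow> x i = 0"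
  shows "h x = 0"
proof -
  \<comment> \<open>Coordinates below \<open>k\<close> are arbitrary, those from \<open>k\<close> to
    \<open>d - 1\<close> still lie on the grid.\<close>
  have "h x = 0" if "\<forall>i\<ge>d. x i = 0" "\<forall>i. k \<le> i \<longrightarrow> i < d \<longrightarrow> x i \<in> of_nat ` {..K}" for k x
    using that
  proof (induction k arbitrary: x)
    case 0
    then have "\<forall>i\<in>{..<d}. \<exists>n\<in>{..K}. x i = of_nat n" by auto
    then obtain y where y: "\<forall>i\<in>{..<d}. y i \<in> {..K} \<and> x i = of_nat (y i)" by metis
    have "x = (\<lambda>i. if i < d then of_nat (restrict y {..<d} i) else 0)"
      using y 0(1) by (auto simp: fun_eq_iff)
    then show ?case using grid[of "restrict y {..<d}"] y by simp
  next
    case (Suc k)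
    show ?case
    proof (cases "k < d")
      case False
      then show ?thesis using Suc by auto
    next
      case True
      have "h (x(k := of_nat n)) = 0" if "n \<le> K" for n
        by (rule Suc.IH) (use Suc.prems True that in \<open>auto simp: Suc_le_eq\<close>)
      then have "h (x(k := x k)) = 0"
        by (rule poly_degree_le_zero_on_grid[OF h])
      then show ?thesis by simp
    qed
  qed
  from this[of x d] show ?thesis using x by simp
qed

text \<open>Numerator of a monomial in the quotients \<open>H i / q\<close> over the denominator
  \<open>q ^ (N * length a)\<close> shared by all monomials. Each variable contributes
  \<open>N\<close> factors whatever its exponent, which makes the degree bound uniform.\<close>

fun homogenized_monomial ::
  "nat \<Rightarrow> (nat \<Rightarrow> complex^2^2 \<Rightarrow> complex) \<Rightarrow> (complex^2^2 \<Rightarrow> complex) \<Rightarrow> nat list \<Rightarrow> complex^2^2 \<Rightarrow> complex" where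
  "homogenized_monomial N H q [] g = 1"
| "homogenized_monomial N H q (j # a) g =
     (H (length a) g ^ j * q g ^ (N - j)) * homogenized_monomial N H q a g"

lemma line_poly_homogenized_monomial:
  assumes "set a \<subseteq> {..N}" "\<And>i. i < length a \<Longrightarrow> line_poly E (H i)" "line_poly E q"
  shows "line_poly (length a * (N * E)) (homogenized_monomial N H q a)"
  using assms
proof (induction a)
  case Nil
  then show ?case using line_poly_const by simp
next
  case (Cons j a)
  have "line_poly ((j * E + (N - j) * E) + length a * (N * E))
      (\<lambda>g. (H (length a) g ^ j * q g ^ (N - j)) * homogenized_monomial N H q a g)"
    using Cons by (intro line_poly_mult line_poly_power) auto
  moreover have "j * E + (N - j) * E = N * E"
    using Cons.prems(1) by (simp add: add_mult_distrib[symmetric])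
  ultimately show ?case by (simp add: fun_eq_iff[symmetric])
qed

lemma homogenized_monomial_eq:
  assumes "set a \<subseteq> {..N}" "\<And>i. i < length a \<Longrightarrow> f i * q g = H i g"
  shows "monomial a f * q g ^ (N * length a) = homogenized_monomial N H q a g"
  using assms
proof (induction a)
  case (Cons j a)
  have "H (length a) g ^ j = f (length a) ^ j * q g ^ j"
    using Cons.prems(2)[of "length a"] by (simp add: power_mult_distrib[symmetric])
  moreover have "q g ^ (N * length (j # a)) = (q g ^ j * q g ^ (N - j)) * q g ^ (N * length a)"
    using Cons.prems(1) by (simp add: power_add[symmetric])
  ultimately show ?case using Cons.IH Cons.prems by (simp add: mult_ac)
qed simp

text \<open>Affine in each variable separately, which is all that restriction to lines
  requires.\<close>

definition affine_parametrization :: "((nat \<Rightarrow> complex) \<Rightarrow> complex^2^2) \<Rightarrow> bool" where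
  "affine_parametrization l \<longleftrightarrow> (\<forall>x i. \<exists>g k. \<forall>t. l (x(i := t)) = line g k t)"

definition parametrized_part ::
  "product \<times> product \<Rightarrow> nat \<Rightarrow> ((nat \<Rightarrow> complex) \<Rightarrow> complex^2^2) \<Rightarrow> (product \<times> product) set" where
  "parametrized_part A d l = {act (l x) A | x. det (l x) \<noteq> 0 \<and> (\<forall>i\<ge>d. x i = 0)}"

lemma algebraically_dependent_parametrized_part:
  assumes A: "A \<in> bil_pairs" and l: "affine_parametrization l"
  shows "algebraically_dependent (Suc d) (parametrized_part A d l)"
  unfolding algebraically_dependent_def
proof (intro allI impI)
  fix f :: "nat \<Rightarrow> product \<times> product \<Rightarrow> complex"
  assume f: "\<forall>i<Suc d. polynomial_fun (f i)"
  let ?m = "Suc d"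
  have "\<forall>i\<in>{..<?m}. \<exists>n D H. line_poly D H \<and> (\<forall>g. det g \<noteq> 0 \<longrightarrow> f i (act g A) * det g ^ n = H g)"
    using polynomial_fun_act_line_poly[OF A] f by auto
  then obtain n D H where H: "\<And>i. i < ?m \<Longrightarrow> line_poly (D i) (H i)"
    "\<And>i g. i < ?m \<Longrightarrow> det g \<noteq> 0 \<Longrightarrow> f i (act g A) * det g ^ n i = H i g"
    unfolding bchoice_iff by (metis lessThan_iff)
  \<comment> \<open>A common exponent for the denominators; \<open>E\<close> then bounds the degrees
    of all numerators \<open>H' i\<close> and of the common denominator \<open>q\<close>.\<close>
  define n' where "n' = (\<Sum>i<?m. n i)"
  have n': "n i \<le> n'" if "i < ?m" for i
    unfolding n'_def by (rule member_le_sum) (use that in auto)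
  define E where "E = (\<Sum>i<?m. D i) + 2 * n'"
  define q where "q g = det g ^ n'" for g :: "complex^2^2"
  define H' where "H' i g = H i g * det g ^ (n' - n i)" for i g
  have q: "line_poly E q"
    unfolding q_def using line_poly_mono[OF line_poly_power[OF line_poly_det]] by (simp add: E_def)
  have H'_poly: "line_poly E (H' i)" if "i < ?m" for i
  proof -
    have "line_poly (D i + (n' - n i) * 2) (H' i)"
      unfolding H'_def by (intro line_poly_mult line_poly_power line_poly_det H that)
    moreover have "D i \<le> (\<Sum>i<?m. D i)"
      by (rule member_le_sum) (use that in auto)
    ultimately show ?thesis by (elim line_poly_mono) (simp add: E_def)
  qed
  have H'_eq: "f i (act g A) * q g = H' i g" if "i < ?m" "det g \<noteq> 0" for i g
    using H(2)[OF that] n'[OF that(1)]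
    by (simp add: H'_def q_def power_add[symmetric] mult.assoc flip: H(2)[OF that])
  \<comment> \<open>The degree bound is \<open>K = M * N\<close>. The grid has
    \<open>(K + 1)^d\<close> points, at most \<open>((M + 1) * (N + 1))^d\<close>. With
    \<open>N = (M + 1)^d\<close> this is \<open>N * (N + 1)^d\<close>, less than the number
    \<open>(N + 1)^(d + 1)\<close> of monomials.\<close>
  define M where "M = ?m * E"
  define N where "N = Suc M ^ d"
  define K where "K = ?m * (N * E)"
  define h where "h a x = homogenized_monomial N H' q a (l x)" for a x
  have h_poly: "poly_degree_le K (\<lambda>t. h a (x(i := t)))" if "a \<in> exponents N ?m" for a x i
  proof -
    obtain g k where gk: "\<And>t. l (x(i := t)) = line g k t"
      using l unfolding affine_parametrization_def by blast
    have "line_poly (length a * (N * E)) (homogenized_monomial N H' q a)"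
      by (rule line_poly_homogenized_monomial) (use that H'_poly q in \<open>auto simp: exponents_def\<close>)
    moreover have "length a * (N * E) = K" using that by (simp add: exponents_def K_def)
    ultimately show ?thesis unfolding h_def gk line_poly_def by simp
  qed
  let ?J = "{..<d} \<rightarrow>\<^sub>E {..K}"
  have "card ?J = Suc K ^ d" by (simp add: card_PiE)
  also have "\<dots> \<le> (Suc M * Suc N) ^ d"
  proof (rule power_mono)
    have "K = M * N" by (simp only: K_def M_def mult_ac)
    then show "Suc K \<le> Suc M * Suc N" by simp
  qed simp
  also have "\<dots> < Suc N ^ ?m"
    by (simp add: power_mult_distrib N_def del: mult_Suc mult_Suc_right)
  also have "\<dots> = card (exponents N ?m)" by (simp add: card_exponents)
  finally have card: "card ?J < card (exponents N ?m)" .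
  \<comment> \<open>One unknown coefficient per monomial, one equation per grid point.\<close>
  obtain c where c: "\<exists>a\<in>exponents N ?m. c a \<noteq> 0"
    "\<And>y. y \<in> ?J \<Longrightarrow> (\<Sum>a\<in>exponents N ?m. c a * h a (\<lambda>i. if i < d then of_nat (y i) else 0)) = 0"
    using homogeneous_system_nontrivial[OF _ finite_exponents card,
        of "\<lambda>a y. h a (\<lambda>i. if i < d then of_nat (y i) else 0)"]
    by (auto simp: finite_PiE)
  have zero: "(\<Sum>a\<in>exponents N ?m. c a * h a x) = 0" if x: "\<And>i. d \<le> i \<Longrightarrow> x i = 0" for x
  proof (rule zero_on_grid_imp_zero[of K "\<lambda>x. \<Sum>a\<in>exponents N ?m. c a * h a x" d])
    show "poly_degree_le K (\<lambda>t. \<Sum>a\<in>exponents N ?m. c a * h a (x(i := t)))" for x i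
    proof -
      have "poly_degree_le K (\<lambda>t. \<Sum>a\<in>F. c a * h a (x(i := t)))"
        if "finite F" "F \<subseteq> exponents N ?m" for F
        using that
      proof (induction F)
        case empty
        then show ?case by (simp add: poly_degree_le_const)
      next
        case (insert a F)
        then have "poly_degree_le (0 + K) (\<lambda>t. c a * h a (x(i := t)))"
          by (intro poly_degree_le_mult poly_degree_le_const h_poly) auto
        moreover have "poly_degree_le K (\<lambda>t. \<Sum>a\<in>F. c a * h a (x(i := t)))"
          using insert by blast
        ultimately show ?case
          unfolding sum.insert[OF insert.hyps] add_0 by (rule poly_degree_le_add)
      qed
      then show ?thesis using finite_exponents by blast
    qed
  qed (use c(2) x in auto)
  have "nested_poly N ?m c (\<lambda>i. f i B) = 0" if B: "B \<in> parametrized_part A d l" for B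
  proof -
    obtain x where x: "B = act (l x) A" "det (l x) \<noteq> 0" "\<And>i. d \<le> i \<Longrightarrow> x i = 0"
      using B unfolding parametrized_part_def by blast
    have mon: "monomial a (\<lambda>i. f i B) * q (l x) ^ (N * ?m) = h a x" if "a \<in> exponents N ?m" for a
      using homogenized_monomial_eq[of a N "\<lambda>i. f i B" q "l x" H'] that H'_eq[OF _ x(2)] x(1)
      by (auto simp: exponents_def h_def)
    have "nested_poly N ?m c (\<lambda>i. f i B) * q (l x) ^ (N * ?m) = (\<Sum>a\<in>exponents N ?m. c a * h a x)"
      unfolding nested_poly_eq_sum sum_distrib_right
      by (rule sum.cong) (simp_all only: mult.assoc mon)
    also have "\<dots> = 0" using zero x(3) by blast
    finally show ?thesis using x(2) by (simp add: q_def)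
  qed
  then show "\<exists>N c. (\<exists>a\<in>exponents N ?m. c a \<noteq> 0) \<and>
      (\<forall>B\<in>parametrized_part A d l. nested_poly N ?m c (\<lambda>i. f i B) = 0)"
    using c(1) by blast
qed

section \<open>Lower bounds from nested affine spaces of matrices\<close>

definition line_closed :: "(complex^2^2) set \<Rightarrow> bool" where
  "line_closed L \<longleftrightarrow> (\<forall>g\<in>L. \<forall>h\<in>L. \<forall>t. line g (h - g) t \<in> L)"

definition orbit_part :: "product \<times> product \<Rightarrow> (complex^2^2) set \<Rightarrow> (product \<times> product) set" where
  "orbit_part A L = {act g A | g. g \<in> L \<and> det g \<noteq> 0}"

lemma orbit_eq_orbit_part: "orbit A = orbit_part A UNIV"
  by (auto simp: orbit_def orbit_part_def invertible_det_nz)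

text \<open>Suppose \<open>p\<close> is nonzero at one point and \<open>q\<close> at another. On the
  line joining the two matrices, the numerators of \<open>p\<close> and \<open>q\<close> and the
  determinant are nonzero polynomials in \<open>t\<close>, so some \<open>t\<close> avoids all their
  zeros.\<close>

lemma prime_set_orbit_part:
  assumes A: "A \<in> bil_pairs" and L: "line_closed L" and g0: "g0 \<in> L" "det g0 \<noteq> 0"
  shows "prime_set (orbit_part A L)"
  unfolding prime_set_def
proof (intro conjI allI impI)
  show "orbit_part A L \<noteq> {}" using g0 unfolding orbit_part_def by blast
  fix p q assume pq: "polynomial_fun p" "polynomial_fun q" "\<forall>B\<in>orbit_part A L. p B * q B = 0"
  show "(\<forall>B\<in>orbit_part A L. p B = 0) \<or> (\<forall>B\<in>orbit_part A L. q B = 0)"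
  proof (rule ccontr)
    assume "\<not> ?thesis"
    then obtain g h where g: "g \<in> L" "det g \<noteq> 0" "p (act g A) \<noteq> 0"
      and h: "h \<in> L" "det h \<noteq> 0" "q (act h A) \<noteq> 0"
      unfolding orbit_part_def by blast
    obtain n D H where H: "line_poly D H" "\<And>g. det g \<noteq> 0 \<Longrightarrow> p (act g A) * det g ^ n = H g"
      using polynomial_fun_act_line_poly[OF A pq(1)] by blast
    obtain m E K where K: "line_poly E K" "\<And>g. det g \<noteq> 0 \<Longrightarrow> q (act g A) * det g ^ m = K g"
      using polynomial_fun_act_line_poly[OF A pq(2)] by blast
    let ?l = "line g (h - g)"
    have l: "?l 0 = g" "?l 1 = h" by (simp_all add: line_def vec_eq_iff)
    have "H (?l 0) \<noteq> 0" "K (?l 1) \<noteq> 0" "det (?l 0) \<noteq> 0"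
      using g h unfolding l by (auto simp flip: H(2) K(2))
    moreover have "poly_degree_le D (\<lambda>t. H (?l t))" "poly_degree_le E (\<lambda>t. K (?l t))"
      "poly_degree_le 2 (\<lambda>t. det (?l t))"
      using H(1) K(1) line_poly_det unfolding line_poly_def by blast+
    ultimately have "finite {t. H (?l t) = 0}" "finite {t. K (?l t) = 0}" "finite {t. det (?l t) = 0}"
      using poly_degree_le_finite_zeros by auto
    then have "finite ({t. H (?l t) = 0} \<union> {t. K (?l t) = 0} \<union> {t. det (?l t) = 0})" by simp
    then obtain t where "t \<notin> {t. H (?l t) = 0} \<union> {t. K (?l t) = 0} \<union> {t. det (?l t) = 0}"
      using ex_new_if_finite[OF infinite_UNIV_char_0] by metis
    then have t: "H (?l t) \<noteq> 0" "K (?l t) \<noteq> 0" "det (?l t) \<noteq> 0" by simp_all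
    have "act (?l t) A \<in> orbit_part A L"
      using L g(1) h(1) t(3) unfolding orbit_part_def line_closed_def by blast
    then have "p (act (?l t) A) * q (act (?l t) A) = 0" using pq(3) by blast
    then show False using t H(2)[OF t(3)] K(2)[OF t(3)] by auto
  qed
qed

text \<open>The index counts strict steps, not the dimension of \<open>L\<close>: directions inside
  the stabilizer do not enlarge the orbit part, so a step may skip dimensions.\<close>

inductive flag :: "product \<times> product \<Rightarrow> nat \<Rightarrow> (complex^2^2) set \<Rightarrow> bool" for A where
  flag_0: "line_closed L \<Longrightarrow> g \<in> L \<Longrightarrow> det g \<noteq> 0 \<Longrightarrow> flag A 0 L"
| flag_Suc: "flag A d L \<Longrightarrow> line_closed L' \<Longrightarrow> L \<subseteq> L' \<Longrightarrow> polynomial_fun p \<Longrightarrow>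
    (\<And>g. g \<in> L \<Longrightarrow> det g \<noteq> 0 \<Longrightarrow> p (act g A) = 0) \<Longrightarrow>
    g \<in> L' \<Longrightarrow> det g \<noteq> 0 \<Longrightarrow> p (act g A) \<noteq> 0 \<Longrightarrow> flag A (Suc d) L'"

lemma flag_imp_orbit_dim_ge:
  assumes A: "A \<in> bil_pairs" and flag: "flag A d L"
  shows "enat d \<le> orbit_dim A"
proof -
  have "\<exists>T. T d = orbit_part A L \<and> (\<forall>i\<le>d. prime_set (T i) \<and> T i \<subseteq> orbit A) \<and>
     (\<forall>i<d. T i \<subseteq> T (Suc i) \<and>
       (\<exists>p. polynomial_fun p \<and> (\<forall>B\<in>T i. p B = 0) \<and> (\<exists>B\<in>T (Suc i). p B \<noteq> 0)))"
    using flag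
  proof induction
    case (flag_0 L g)
    then show ?case
      using prime_set_orbit_part[OF A]
      by (intro exI[of _ "\<lambda>_. orbit_part A L"]) (auto simp: orbit_eq_orbit_part orbit_part_def)
  next
    case (flag_Suc d L L' p g)
    then obtain T where T: "T d = orbit_part A L" "\<And>i. i \<le> d \<Longrightarrow> prime_set (T i) \<and> T i \<subseteq> orbit A"
     "\<And>i. i < d \<Longrightarrow> T i \<subseteq> T (Suc i) \<and>
       (\<exists>p. polynomial_fun p \<and> (\<forall>B\<in>T i. p B = 0) \<and> (\<exists>B\<in>T (Suc i). p B \<noteq> 0))" by blast
    define T' where "T' = T(Suc d := orbit_part A L')"
    have "prime_set (T' i) \<and> T' i \<subseteq> orbit A" if "i \<le> Suc d" for i
      using T(2)[of i] that flag_Suc prime_set_orbit_part[OF A]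
      by (auto simp: T'_def le_Suc_eq orbit_eq_orbit_part orbit_part_def)
    moreover have "T' i \<subseteq> T' (Suc i) \<and>
       (\<exists>p. polynomial_fun p \<and> (\<forall>B\<in>T' i. p B = 0) \<and> (\<exists>B\<in>T' (Suc i). p B \<noteq> 0))" if "i < Suc d" for i
    proof (cases "i = d")
      case False
      then show ?thesis using T(3)[of i] that by (simp add: T'_def)
    next
      case True
      have "orbit_part A L \<subseteq> orbit_part A L'" using flag_Suc by (auto simp: orbit_part_def)
      moreover have "\<forall>B\<in>orbit_part A L. p B = 0" "\<exists>B\<in>orbit_part A L'. p B \<noteq> 0"
        using flag_Suc unfolding orbit_part_def by blast+
      ultimately show ?thesis using True T(1) flag_Suc by (auto simp: T'_def)
    qed
    moreover have "T' (Suc d) = orbit_part A L'" by (simp add: T'_def)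
    ultimately show ?case by (intro exI[of _ T']) blast
  qed
  then obtain T where T: "\<forall>i\<le>d. prime_set (T i) \<and> T i \<subseteq> orbit A"
    "\<forall>i<d. T i \<subseteq> T (Suc i) \<and>
       (\<exists>p. polynomial_fun p \<and> (\<forall>B\<in>T i. p B = 0) \<and> (\<exists>B\<in>T (Suc i). p B \<noteq> 0))"
    by (elim exE conjE)
  show ?thesis
    unfolding orbit_dim_def
    by (rule krull_dim_ge[OF orbit_subset_bil_pairs[OF A], of d T]) (use T in simp_all)
qed

section \<open>The group action and the dimension criterion\<close>

lemma act_eq_iff:
  assumes "invertible g"
  shows "act g (\<mu>, \<nu>) = (\<mu>', \<nu>') \<longleftrightarrow>
    (\<forall>x y. g *v \<mu> x y = \<mu>' (g *v x) (g *v y)) \<and> (\<forall>x y. g *v \<nu> x y = \<nu>' (g *v x) (g *v y))"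
proof -
  have "(\<lambda>x y. g *v \<mu> (matrix_inv g *v x) (matrix_inv g *v y)) = \<mu>' \<longleftrightarrow>
      (\<forall>x y. g *v \<mu> x y = \<mu>' (g *v x) (g *v y))" for \<mu> \<mu>'
    unfolding fun_eq_iff using matrix_inv_cancel(3,4)[OF assms] by metis
  then show ?thesis by (simp add: act_def)
qed

lemma isomorphic_alg_iff_act:
  "isomorphic_alg A B \<longleftrightarrow> (\<exists>g. invertible g \<and> act g A = B)"
  by (cases A; cases B) (auto simp: isomorphic_alg_def act_eq_iff cong: conj_cong)

lemma isomorphic_alg_iff_orbit: "isomorphic_alg A B \<longleftrightarrow> B \<in> orbit A"
  by (auto simp: isomorphic_alg_iff_act orbit_def)

lemma act_mult:
  assumes "invertible g" "invertible h"
  shows "act (g ** h) A = act g (act h A)"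
proof -
  note inv = matrix_inv_cancel(1,2)
  have gh: "invertible (g ** h)" by (rule invertible_mult[OF assms])
  have eq: "matrix_inv (g ** h) = matrix_inv h ** matrix_inv g"
  proof -
    have "(g ** h) ** (matrix_inv h ** matrix_inv g) = (g ** (h ** matrix_inv h)) ** matrix_inv g"
      by (simp only: matrix_mul_assoc)
    then have "(g ** h) ** (matrix_inv h ** matrix_inv g) = mat 1"
      using inv[OF assms(1)] inv[OF assms(2)] by simp
    then have "matrix_inv (g ** h) = matrix_inv (g ** h) ** ((g ** h) ** (matrix_inv h ** matrix_inv g))"
      by simp
    also have "\<dots> = (matrix_inv (g ** h) ** (g ** h)) ** (matrix_inv h ** matrix_inv g)"
      by (simp only: matrix_mul_assoc)
    also have "\<dots> = matrix_inv h ** matrix_inv g"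
      using inv[OF gh] by simp
    finally show ?thesis .
  qed
  show ?thesis
    by (simp add: act_def eq matrix_vector_mul_assoc case_prod_unfold)
qed

text \<open>Since \<open>act (g ** s) A = act g A\<close> for a stabilizing \<open>s\<close>, the
  hypothesis \<open>cover\<close> puts the whole orbit into two parametrized parts.\<close>

lemma orbit_dim_eqI:
  assumes A: "A \<in> bil_pairs" and flag: "flag A d L"
    and l: "affine_parametrization l" "affine_parametrization l'"
    and cover: "\<And>g. det g \<noteq> 0 \<Longrightarrow> \<exists>s x. det s \<noteq> 0 \<and> act s A = A \<and>
      (\<forall>i\<ge>d. x i = 0) \<and> (g ** s = l x \<or> g ** s = l' x)"
  shows "orbit_dim A = enat d"
proof (rule antisym)
  have "orbit A \<subseteq> parametrized_part A d l \<union> parametrized_part A d l'"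
  proof
    fix B assume "B \<in> orbit A"
    then obtain g where g: "B = act g A" "det g \<noteq> 0"
      by (auto simp: orbit_def invertible_det_nz)
    obtain s x where s: "det s \<noteq> 0" "act s A = A" "\<forall>i\<ge>d. x i = 0" "g ** s = l x \<or> g ** s = l' x"
      using cover[OF g(2)] by blast
    have "B = act (g ** s) A" "det (g ** s) \<noteq> 0"
      using g s by (simp_all add: act_mult invertible_det_nz det_mul)
    then show "B \<in> parametrized_part A d l \<union> parametrized_part A d l'"
      using s(3,4) unfolding parametrized_part_def by auto
  qed
  then show "orbit_dim A \<le> enat d"
    unfolding orbit_dim_def
    by (rule krull_dim_le[OF orbit_subset_bil_pairs[OF A]])
      (rule algebraically_dependent_parametrized_part[OF A]; fact l)+
  show "enat d \<le> orbit_dim A" by (rule flag_imp_orbit_dim_ge[OF A flag])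
qed

section \<open>Degenerations\<close>

text \<open>For fixed \<open>g\<close> a change of basis is linear in the structure constants. The
  identity is confined to \<open>bil_pairs\<close>, since these constants determine a product only
  if it is bilinear.\<close>

lemma polynomial_fun_comp_act:
  assumes "polynomial_fun p"
  shows "\<exists>q. polynomial_fun q \<and> (\<forall>A\<in>bil_pairs. q A = p (act g A))"
proof -
  have expand: "(g *v \<mu> u v) $ k = (\<Sum>l\<in>UNIV. g $ k $ l * (\<Sum>i\<in>UNIV. \<Sum>j\<in>UNIV. u $ i * v $ j * \<mu> (e i) (e j) $ l))"
    if "bilinear_map \<mu>" for \<mu> u v k
    unfolding matrix_vector_mult_2 sum_2
    by (subst (1 2) bilinear_map_eq_table[OF that]) (simp add: table_nth algebra_simps)
  show ?thesis
    using assms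
  proof induction
    case (coord_fst i j k)
    show ?case
      by (rule exI[of _ "\<lambda>A. \<Sum>l\<in>UNIV. g $ k $ l * (\<Sum>i'\<in>UNIV. \<Sum>j'\<in>UNIV.
            (matrix_inv g *v e i) $ i' * (matrix_inv g *v e j) $ j' * fst A (e i') (e j') $ l)"])
        (auto intro!: polynomial_fun_intros simp: bil_pairs_def act_def expand)
  next
    case (coord_snd i j k)
    show ?case
      by (rule exI[of _ "\<lambda>A. \<Sum>l\<in>UNIV. g $ k $ l * (\<Sum>i'\<in>UNIV. \<Sum>j'\<in>UNIV.
            (matrix_inv g *v e i) $ i' * (matrix_inv g *v e j) $ j' * snd A (e i') (e j') $ l)"])
        (auto intro!: polynomial_fun_intros simp: bil_pairs_def act_def expand)
  next
    case (const c)
    then show ?case using polynomial_fun.const by blast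
  next
    case (add p q)
    then obtain p' q' where "polynomial_fun p'" "\<forall>A\<in>bil_pairs. p' A = p (act g A)"
      "polynomial_fun q'" "\<forall>A\<in>bil_pairs. q' A = q (act g A)" by blast
    then show ?case
      by (intro exI[of _ "\<lambda>A. p' A + q' A"]) (simp add: polynomial_fun.add)
  next
    case (mult p q)
    then obtain p' q' where "polynomial_fun p'" "\<forall>A\<in>bil_pairs. p' A = p (act g A)"
      "polynomial_fun q'" "\<forall>A\<in>bil_pairs. q' A = q (act g A)" by blast
    then show ?case
      by (intro exI[of _ "\<lambda>A. p' A * q' A"]) (simp add: polynomial_fun.mult)
  qed
qed

lemma act_mat_1: "act (mat 1) A = A"
proof -
  have "matrix_inv (mat 1 :: complex^2^2) *v x = x" for x
    by (simp add: vec_eq_iff forall_2 matrix_inv_mult_2) (simp add: mat_def)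
  then show ?thesis by (simp add: act_def case_prod_unfold)
qed

lemma in_orbit_self: "A \<in> orbit A"
  unfolding orbit_def mem_Collect_eq
  by (rule exI[of _ "mat 1"]) (simp add: act_mat_1 invertible_det_nz)

text \<open>Base change by \<open>h\<close> pulls polynomials back to polynomials and maps the orbit
  into itself.\<close>

lemma zariski_closure_act:
  assumes A: "A \<in> bil_pairs" and B: "B \<in> zariski closure_of orbit A" and h: "invertible h"
  shows "act h B \<in> zariski closure_of orbit A"
proof -
  note cl = in_closure_of_zariski[OF orbit_subset_bil_pairs[OF A]]
  have "p (act h B) = 0" if p: "polynomial_fun p" "\<forall>C\<in>orbit A. p C = 0" for p
  proof -
    obtain q where q: "polynomial_fun q" "\<forall>C\<in>bil_pairs. q C = p (act h C)"
      using polynomial_fun_comp_act[OF p(1)] by blast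
    have "q C = 0" if C: "C \<in> orbit A" for C
    proof -
      obtain g where g: "C = act g A" "invertible g" using C unfolding orbit_def by blast
      have "act h C \<in> orbit A"
        using invertible_mult[OF h g(2)] unfolding g(1) act_mult[OF h g(2), symmetric] orbit_def by blast
      then show ?thesis
        using p(2) q(2) orbit_subset_bil_pairs[OF A] C by auto
    qed
    then have "q B = 0" using B cl q(1) by blast
    then show ?thesis using q(2) B cl by auto
  qed
  then show ?thesis using B cl act_bil_pairs by auto
qed

text \<open>The closure is stable under base change, so the representative in the definition may be
  \<open>B\<close> itself.\<close>

lemma degenerates_iff:
  assumes "A \<in> bil_pairs"
  shows "degenerates A B \<longleftrightarrow> B \<in> zariski closure_of orbit A"
proof
  assume "degenerates A B"
  then obtain g where g: "invertible g" "act g B \<in> zariski closure_of orbit A"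
    unfolding degenerates_def isomorphic_alg_iff_act by blast
  obtain h where h: "g ** h = mat 1" "h ** g = mat 1"
    using g(1) unfolding invertible_def by blast
  then have inv: "invertible h" unfolding invertible_def by blast
  have "B = act h (act g B)"
    using act_mult[OF inv g(1)] h by (simp add: act_mat_1)
  then show "B \<in> zariski closure_of orbit A"
    using zariski_closure_act[OF assms g(2) inv] by simp
next
  assume "B \<in> zariski closure_of orbit A"
  then show "degenerates A B"
    using in_orbit_self unfolding degenerates_def isomorphic_alg_iff_orbit by blast
qed

lemma degenerates_trans:
  assumes A: "A \<in> bil_pairs" and AB: "degenerates A B" and BC: "degenerates B C"
  shows "degenerates A C"
proof -
  have B: "B \<in> zariski closure_of orbit A" using AB degenerates_iff[OF A] by blast
  then have Bb: "B \<in> bil_pairs" using in_closure_of_zariski[OF orbit_subset_bil_pairs[OF A]] by blast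
  have "orbit B \<subseteq> zariski closure_of orbit A"
    using zariski_closure_act[OF A B] by (auto simp: orbit_def)
  then have "zariski closure_of orbit B \<subseteq> zariski closure_of orbit A"
    by (rule closure_of_minimal) simp
  then show ?thesis using BC degenerates_iff[OF A] degenerates_iff[OF Bb] by blast
qed

lemma isomorphic_imp_degenerates:
  "A \<in> bil_pairs \<Longrightarrow> isomorphic_alg A B \<Longrightarrow> degenerates A B"
  using closure_of_subset[of "orbit A" zariski] orbit_subset_bil_pairs[of A]
  by (auto simp: degenerates_iff isomorphic_alg_iff_orbit topspace_zariski)

lemma degenerates_imp_polynomial_zero:
  assumes "A \<in> bil_pairs" "degenerates A B" "polynomial_fun p" "\<And>g. det g \<noteq> 0 \<Longrightarrow> p (act g A) = 0"
  shows "p B = 0"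
proof -
  have "\<forall>C\<in>orbit A. p C = 0" using assms(4) by (auto simp: orbit_def invertible_det_nz)
  then show ?thesis
    using assms(2,3) in_closure_of_zariski[OF orbit_subset_bil_pairs[OF assms(1)]]
    unfolding degenerates_iff[OF assms(1)] by blast
qed

text \<open>Along the line, a polynomial vanishing on the orbit becomes a polynomial in
  \<open>t\<close> with infinitely many zeros \<open>t \<noteq> 0\<close>, so it also vanishes at
  \<open>t = 0\<close>.\<close>

lemma degenerates_line:
  assumes A: "A \<in> bil_pairs" and F0: "F 0 \<in> bil_pairs" and iso: "\<And>t. t \<noteq> 0 \<Longrightarrow> isomorphic_alg A (F t)"
    and lin: "\<And>t i j k. fst (F t) (e i) (e j) $ k
        = fst (F 0) (e i) (e j) $ k + t * (fst (F 1) (e i) (e j) $ k - fst (F 0) (e i) (e j) $ k)"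
      "\<And>t i j k. snd (F t) (e i) (e j) $ k
        = snd (F 0) (e i) (e j) $ k + t * (snd (F 1) (e i) (e j) $ k - snd (F 0) (e i) (e j) $ k)"
  shows "degenerates A (F 0)"
proof -
  have "p (F 0) = 0" if p: "polynomial_fun p" "\<forall>B\<in>orbit A. p B = 0" for p
  proof -
    have "\<exists>D. poly_degree_le D (\<lambda>t. p (F t))"
      using p(1)
    proof induction
      case (coord_fst i j k)
      show ?case using poly_degree_le_linear[of 1] by (subst lin(1)) blast
    next
      case (coord_snd i j k)
      show ?case using poly_degree_le_linear[of 1] by (subst lin(2)) blast
    next
      case (add p q)
      then obtain D E where "poly_degree_le D (\<lambda>t. p (F t))" "poly_degree_le E (\<lambda>t. q (F t))" by blast
      then have "poly_degree_le (D + E) (\<lambda>t. p (F t))" "poly_degree_le (D + E) (\<lambda>t. q (F t))"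
        by (auto elim: poly_degree_le_mono)
      then show ?case using poly_degree_le_add by blast
    qed (use poly_degree_le_const poly_degree_le_mult in blast)+
    then obtain D where D: "poly_degree_le D (\<lambda>t. p (F t))" by blast
    have "p (F t) = 0" if "t \<noteq> 0" for t
      using p(2) iso[OF that] by (simp add: isomorphic_alg_iff_orbit)
    then have "- {0} \<subseteq> {t. p (F t) = 0}" by auto
    moreover have "infinite (- {0 :: complex})"
      by (simp add: infinite_UNIV_char_0 finite_compl)
    ultimately have "infinite {t. p (F t) = 0}" using finite_subset by blast
    then show ?thesis using poly_degree_le_finite_zeros[OF D] by blast
  qed
  then show ?thesis
    using F0 by (simp add: degenerates_iff[OF A] in_closure_of_zariski[OF orbit_subset_bil_pairs[OF A]])
qed

section \<open>Explicit lines realising the basic degenerations\<close>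

definition mat2 :: "complex \<Rightarrow> complex \<Rightarrow> complex \<Rightarrow> complex \<Rightarrow> complex^2^2" where
  "mat2 a b c d = vector [vector [a, b], vector [c, d]]"

lemma mat2_nth:
  "mat2 a b c d $ 1 $ 1 = a" "mat2 a b c d $ 1 $ 2 = b"
  "mat2 a b c d $ 2 $ 1 = c" "mat2 a b c d $ 2 $ 2 = d"
  by (simp_all add: mat2_def)

lemma det_mat2: "det (mat2 a b c d) = a * d - b * c"
  by (simp add: det_2 mat2_nth)

text \<open>The primed vectors are the direction of the line. \<open>g t\<close> may have a pole at
  \<open>t = 0\<close>; only the transformed products must be affine in \<open>t\<close>.\<close>

lemma degenerates_table_line:
  assumes A: "(\<mu>, \<nu>) \<in> bil_pairs" and det: "\<And>t. t \<noteq> 0 \<Longrightarrow> det (g t) \<noteq> 0"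
    and iso: "\<And>t x y. t \<noteq> 0 \<Longrightarrow> g t *v \<mu> x y =
        table (a + t *s a') (b + t *s b') (c + t *s c') (d + t *s d') (g t *v x) (g t *v y)"
      "\<And>t x y. t \<noteq> 0 \<Longrightarrow> g t *v \<nu> x y =
        table (u + t *s u') (v + t *s v') (w + t *s w') (z + t *s z') (g t *v x) (g t *v y)"
  shows "degenerates (\<mu>, \<nu>) (table a b c d, table u v w z)"
proof -
  define F where "F t = (table (a + t *s a') (b + t *s b') (c + t *s c') (d + t *s d'),
    table (u + t *s u') (v + t *s v') (w + t *s w') (z + t *s z'))" for t
  have "degenerates (\<mu>, \<nu>) (F 0)"
  proof (rule degenerates_line[OF A])
    show "F 0 \<in> bil_pairs" by (simp add: F_def bil_pairs_def bilinear_map_table)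
    show "isomorphic_alg (\<mu>, \<nu>) (F t)" if "t \<noteq> 0" for t
      unfolding isomorphic_alg_def using det[OF that] iso[OF that]
      by (auto simp: invertible_det_nz F_def)
  qed (simp_all add: F_def table_nth algebra_simps)
  then show ?thesis by (simp add: F_def)
qed

text \<open>Scaling by \<open>1 / t\<close> multiplies every structure constant by
  \<open>t\<close>.\<close>

lemma degenerates_zero:
  assumes "(table a b c d, table u v w z) \<in> bil_pairs"
  shows "degenerates (table a b c d, table u v w z) (table 0 0 0 0, table 0 0 0 0)"
  by (rule degenerates_table_line[of _ _ "\<lambda>t. mat2 (1/t) 0 0 (1/t)" 0 a 0 b 0 c 0 d 0 u 0 v 0 w 0 z, OF assms])
    (simp_all add: det_mat2 vec_eq_iff forall_2 matrix_vector_mult_2 mat2_nth table_nth field_simps)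

text \<open>Each \<open>g t\<close> is best read through its inverse, whose columns are the new
  basis \<open>E1\<close>, \<open>E2\<close> in the old coordinates.\<close>

lemma basic_degeneration_imp_degenerates:
  assumes "basic_degeneration T T'"
  shows "degenerates (algebra_of T) (algebra_of T')"
proof -
  note simps = det_mat2 vec_eq_iff forall_2 matrix_vector_mult_2 mat2_nth table_nth e_nth
  note b = algebra_of_bil_pairs
  have "degenerates (algebra_of P07) (algebra_of (P05 0))"
    by (simp only: algebra_of.simps, rule degenerates_table_line[of _ _ "\<lambda>t. mat2 1 0 0 (1/t)" 0 0 0 0 0 0 0 0 "e 1" 0 "0 *s e 2" 0 0 0 0 "e 2"])
      (use b[of P07] in \<open>auto simp: simps field_simps\<close>)
  moreover have "degenerates (algebra_of P07) (algebra_of (P06 1))"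
    by (simp only: algebra_of.simps, rule degenerates_table_line[of _ _ "\<lambda>t. mat2 1 0 (-1/t) (1/t)" 0 0 0 0 0 0 0 0 "e 1" 0 "1 *s e 2" 0 "e 2" 0 0 "e 2"])
      (use b[of P07] in \<open>auto simp: simps field_simps\<close>)
  moreover have "degenerates (algebra_of P08) (algebra_of (P05 (1/2)))"
    by (simp only: algebra_of.simps, rule degenerates_table_line[of _ _ "\<lambda>t. mat2 0 1 (1/t) 0" 0 0 0 0 0 0 0 0
        "e 1" 0 "(1/2) *s e 2" "e 1" 0 "2 *s e 1" 0 "e 2"])
      (use b[of P08] in \<open>auto simp: simps field_simps\<close>)
  moreover have "degenerates (algebra_of P08) (algebra_of (P06 2))"
    by (simp only: algebra_of.simps, rule degenerates_table_line[of _ _ "\<lambda>t. mat2 1 0 0 (1/t)" 0 0 0 0 0 0 0 0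
        "e 1" 0 "2 *s e 2" 0 "e 2" "(1/2) *s e 1" 0 "e 2"])
      (use b[of P08] in \<open>auto simp: simps field_simps\<close>)
  moreover have "degenerates (algebra_of P10) (algebra_of (P06 1))"
    by (simp only: algebra_of.simps, rule degenerates_table_line[of _ _ "\<lambda>t. mat2 1 0 0 t" 0 "e 2" 0 0 0 0 0 0 "e 1" 0 "1 *s e 2" 0 "e 2" 0 0 0])
      (use b[of P10] in \<open>auto simp: simps field_simps\<close>)
  \<comment> \<open>New basis \<open>E1 = t (e1 + \<alpha> e2)\<close>, \<open>E2 = t^2 e2\<close>:
    the first product of \<open>E1\<close> with itself is \<open>E2\<close>, and
    \<open>E1 \<circ> E1 = \<alpha> E2 + t E1\<close>.\<close>
  moreover have "degenerates (algebra_of P10) (algebra_of (P09 \<alpha>))" for \<alpha>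
    by (simp only: algebra_of.simps, rule degenerates_table_line[of _ _ "\<lambda>t. mat2 (1/t) 0 (-\<alpha>/t^2) (1/t^2)" "e 2" 0 0 0 0 0 0 0
        "\<alpha> *s e 2" "e 1" 0 "e 2" 0 "e 2" 0 0])
      (use b[of P10] in \<open>auto simp: simps field_simps power2_eq_square\<close>)
  moreover have "degenerates (algebra_of P01) (algebra_of (P06 0))"
    by (simp only: algebra_of.simps, rule degenerates_table_line[of _ _ "\<lambda>t. mat2 1 0 0 t" 0 0 0 0 0 0 0 0 "e 1" "e 2" "0 *s e 2" 0 "e 2" 0 0 0])
      (use b[of P01] in \<open>auto simp: simps field_simps\<close>)
  moreover have "degenerates (algebra_of P01) (algebra_of P03)"
    by (simp only: algebra_of.simps, rule degenerates_table_line[of _ _ "\<lambda>t. mat2 (1/t) 0 0 (1/t^2)" 0 0 0 0 0 0 0 0 "e 2" "e 1" 0 0 0 "e 2" 0 0])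
      (use b[of P01] in \<open>auto simp: simps field_simps power2_eq_square\<close>)
  moreover have "degenerates (algebra_of P02) (algebra_of (P05 1))"
    by (simp only: algebra_of.simps, rule degenerates_table_line[of _ _ "\<lambda>t. mat2 1 0 0 t" 0 0 0 0 0 0 0 0 "e 1" "e 2" "1 *s e 2" 0 0 0 0 0])
      (use b[of P02] in \<open>auto simp: simps field_simps\<close>)
  moreover have "degenerates (algebra_of P02) (algebra_of P03)"
    by (simp only: algebra_of.simps, rule degenerates_table_line[of _ _ "\<lambda>t. mat2 (1/t) 0 0 (1/t^2)" 0 0 0 0 0 0 0 0 "e 2" "e 1" 0 "e 2" 0 0 0 0])
      (use b[of P02] in \<open>auto simp: simps field_simps power2_eq_square\<close>)
  \<comment> \<open>New basis \<open>E1 = e1 + t e2\<close>, \<open>E2 = t e1\<close>: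
    \<open>E1 \<circ> E1 = E2\<close> and \<open>E1 \<circ> E2 = t E2\<close>.\<close>
  moreover have "degenerates (algebra_of P04) (algebra_of P03)"
    by (simp only: algebra_of.simps, rule degenerates_table_line[of _ _ "\<lambda>t. mat2 0 (1/t) (1/t) (-1/t^2)" 0 0 0 0 0 0 0 0 "e 2" 0 0 "e 2" 0 0 0 0])
      (use b[of P04] in \<open>auto simp: simps field_simps power2_eq_square\<close>)
  \<comment> \<open>New basis \<open>E1 = t e1 + e2\<close> and
    \<open>E2 = E1 \<circ> E1 - t E1 = t (\<alpha> - 1) e2\<close>, which is nonzero exactly because
    \<open>\<alpha> \<noteq> 1\<close>.\<close>
  moreover have "degenerates (algebra_of (P05 \<alpha>)) (algebra_of P03)" if "\<alpha> \<noteq> 1" for \<alpha>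
    by (simp only: algebra_of.simps, rule degenerates_table_line[of _ _ "\<lambda>t. mat2 (1/t) 0 (-1/(t^2*(\<alpha> - 1))) (1/(t*(\<alpha> - 1)))" 0 0 0 0 0 0 0 0
        "e 2" "e 1" 0 "\<alpha> *s e 2" 0 0 0 0])
      (use b[of "P05 \<alpha>"] that in \<open>auto simp: simps divide_simps power2_eq_square, (simp_all add: algebra_simps)?\<close>)
  moreover have "degenerates (algebra_of (P06 \<alpha>)) (algebra_of P03)" if "\<alpha> \<noteq> 0" for \<alpha>
    by (simp only: algebra_of.simps, rule degenerates_table_line[of _ _ "\<lambda>t. mat2 (1/t) 0 (-1/(t^2*\<alpha>)) (1/(t*\<alpha>))" 0 0 0 0 0 0 0 0
        "e 2" "e 1" 0 "\<alpha> *s e 2" 0 "e 2" 0 0])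
      (use b[of "P06 \<alpha>"] that in \<open>auto simp: simps field_simps power2_eq_square\<close>)
  \<comment> \<open>The same \<open>E1\<close>; now
    \<open>E1 \<circ> E1 - t E1 = t \<alpha> e2\<close>.\<close>
  moreover have "degenerates (algebra_of T) (algebra_of C8)" for T
    using b[of T] by (cases T) (simp_all add: degenerates_zero)
  ultimately show ?thesis
    by - (rule basic_degeneration.cases[OF assms]; blast)
qed

section \<open>Orbit dimensions\<close>

text \<open>Coordinate of the preimage of \<open>x\<close>, written out so that structure constants
  after a base change become explicit rational expressions.\<close>

definition preim1 :: "complex^2^2 \<Rightarrow> V \<Rightarrow> complex" where
  "preim1 g x = (g $ 2 $ 2 * x $ 1 - g $ 1 $ 2 * x $ 2) / det g"

definition preim2 :: "complex^2^2 \<Rightarrow> V \<Rightarrow> complex" where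
  "preim2 g x = (g $ 1 $ 1 * x $ 2 - g $ 2 $ 1 * x $ 1) / det g"

definition act_nth :: "complex^2^2 \<Rightarrow> V \<Rightarrow> V \<Rightarrow> V \<Rightarrow> V \<Rightarrow> V \<Rightarrow> V \<Rightarrow> 2 \<Rightarrow> complex" where
  "act_nth g a b c d x y k = (\<Sum>l\<in>UNIV. g $ k $ l *
     (preim1 g x * preim1 g y * a $ l + preim1 g x * preim2 g y * b $ l +
      preim2 g x * preim1 g y * c $ l + preim2 g x * preim2 g y * d $ l))"

lemma act_table_nth:
  assumes "det g \<noteq> 0"
  shows "fst (act g (table a b c d, \<nu>)) x y $ k = act_nth g a b c d x y k"
    and "snd (act g (\<mu>, table a b c d)) x y $ k = act_nth g a b c d x y k"
  unfolding act_def act_nth_def sum_2 preim1_def preim2_def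
  by (simp_all only: prod.case fst_conv snd_conv matrix_vector_mult_2[of g] table_nth
      matrix_inv_mult_2[OF assms])

lemmas act_coord = act_table_nth act_nth_def sum_2 preim1_def preim2_def e_nth mat2_nth det_mat2

definition matrices_one :: "(complex^2^2) set" where
  "matrices_one = {g. g $ 1 $ 1 = 1 \<and> g $ 1 $ 2 = 0 \<and> g $ 2 $ 1 = 0 \<and> g $ 2 $ 2 = 1}"
definition matrices_diag1 :: "(complex^2^2) set" where
  "matrices_diag1 = {g. g $ 1 $ 2 = 0 \<and> g $ 2 $ 1 = 0 \<and> g $ 2 $ 2 = 1}"
definition matrices_diag2 :: "(complex^2^2) set" where
  "matrices_diag2 = {g. g $ 1 $ 1 = 1 \<and> g $ 1 $ 2 = 0 \<and> g $ 2 $ 1 = 0}"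
definition matrices_diag :: "(complex^2^2) set" where
  "matrices_diag = {g. g $ 1 $ 2 = 0 \<and> g $ 2 $ 1 = 0}"
definition matrices_lower :: "(complex^2^2) set" where
  "matrices_lower = {g. g $ 1 $ 2 = 0}"

lemmas matrices_defs = matrices_one_def matrices_diag1_def matrices_diag2_def matrices_diag_def
  matrices_lower_def

lemma line_closed_matrices:
  "line_closed matrices_one" "line_closed matrices_diag1" "line_closed matrices_diag2"
  "line_closed matrices_diag" "line_closed matrices_lower" "line_closed UNIV"
  by (auto simp: line_closed_def matrices_defs line_def)

lemma mem_matrices:
  "g \<in> matrices_one \<longleftrightarrow> g $ 1 $ 1 = 1 \<and> g $ 1 $ 2 = 0 \<and> g $ 2 $ 1 = 0 \<and> g $ 2 $ 2 = 1"
  "g \<in> matrices_diag1 \<longleftrightarrow> g $ 1 $ 2 = 0 \<and> g $ 2 $ 1 = 0 \<and> g $ 2 $ 2 = 1"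
  "g \<in> matrices_diag2 \<longleftrightarrow> g $ 1 $ 1 = 1 \<and> g $ 1 $ 2 = 0 \<and> g $ 2 $ 1 = 0"
  "g \<in> matrices_diag \<longleftrightarrow> g $ 1 $ 2 = 0 \<and> g $ 2 $ 1 = 0"
  "g \<in> matrices_lower \<longleftrightarrow> g $ 1 $ 2 = 0"
  by (simp_all add: matrices_defs)

lemma flag_one: "flag A 0 matrices_one"
  by (rule flag_0[OF line_closed_matrices(1), of "mat2 1 0 0 1"])
    (simp_all add: mem_matrices mat2_nth det_mat2)

lemma flag_coord_snd:
  assumes "flag A n L" "line_closed L'" "L \<subseteq> L'"
    and "\<And>g. g \<in> L \<Longrightarrow> det g \<noteq> 0 \<Longrightarrow> snd (act g A) (e i) (e j) $ k = r"
    and "g \<in> L'" "det g \<noteq> 0" "snd (act g A) (e i) (e j) $ k \<noteq> r"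
  shows "flag A (Suc n) L'"
  by (rule flag_Suc[OF assms(1-3), of "\<lambda>A. snd A (e i) (e j) $ k - r" g])
    (use assms(4-) in \<open>auto intro!: polynomial_fun_diff polynomial_fun.intros\<close>)

lemma flag_coord_fst:
  assumes "flag A n L" "line_closed L'" "L \<subseteq> L'"
    and "\<And>g. g \<in> L \<Longrightarrow> det g \<noteq> 0 \<Longrightarrow> fst (act g A) (e i) (e j) $ k = r"
    and "g \<in> L'" "det g \<noteq> 0" "fst (act g A) (e i) (e j) $ k \<noteq> r"
  shows "flag A (Suc n) L'"
  by (rule flag_Suc[OF assms(1-3), of "\<lambda>A. fst A (e i) (e j) $ k - r" g])
    (use assms(4-) in \<open>auto intro!: polynomial_fun_diff polynomial_fun.intros\<close>)

lemmas flag_simps = line_closed_matrices mem_matrices act_coord det_2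

section \<open>A strict chain in each orbit\<close>

lemma flag_P07: "flag (algebra_of P07) 4 UNIV"
proof -
  have f1: "flag (algebra_of P07) (Suc 0) matrices_diag2"
    by (rule flag_coord_snd[OF flag_one, where i = 2 and j = 2 and k = 2 and r = "1" and g = "mat2 1 0 0 2"])
      (auto simp: flag_simps field_simps)
  have f2: "flag (algebra_of P07) (Suc (Suc 0)) matrices_diag"
    by (rule flag_coord_snd[OF f1, where i = 1 and j = 1 and k = 1 and r = "1" and g = "mat2 2 0 0 1"])
      (auto simp: flag_simps field_simps)
  have f3: "flag (algebra_of P07) (Suc (Suc (Suc 0))) matrices_lower"
    by (rule flag_coord_snd[OF f2, where i = 1 and j = 1 and k = 2 and r = "0" and g = "mat2 1 0 1 1"])
      (auto simp: flag_simps field_simps)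
  have "flag (algebra_of P07) (Suc (Suc (Suc (Suc 0)))) UNIV"
    by (rule flag_coord_snd[OF f3, where i = 2 and j = 2 and k = 1 and r = "0" and g = "mat2 1 1 0 1"])
      (auto simp: flag_simps field_simps)
  then show ?thesis by (simp add: numeral_eq_Suc)
qed

lemma flag_P08: "flag (algebra_of P08) 4 UNIV"
proof -
  have f1: "flag (algebra_of P08) (Suc 0) matrices_diag2"
    by (rule flag_coord_snd[OF flag_one, where i = 2 and j = 1 and k = 1 and r = "1/2" and g = "mat2 1 0 0 2"])
      (auto simp: flag_simps field_simps)
  have f2: "flag (algebra_of P08) (Suc (Suc 0)) matrices_diag"
    by (rule flag_coord_snd[OF f1, where i = 1 and j = 1 and k = 1 and r = "1" and g = "mat2 2 0 0 1"])
      (auto simp: flag_simps field_simps)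
  have f3: "flag (algebra_of P08) (Suc (Suc (Suc 0))) matrices_lower"
    by (rule flag_coord_snd[OF f2, where i = 1 and j = 1 and k = 2 and r = "0" and g = "mat2 1 0 1 1"])
      (auto simp: flag_simps field_simps)
  have "flag (algebra_of P08) (Suc (Suc (Suc (Suc 0)))) UNIV"
    by (rule flag_coord_snd[OF f3, where i = 2 and j = 2 and k = 1 and r = "0" and g = "mat2 1 1 0 1"])
      (auto simp: flag_simps field_simps)
  then show ?thesis by (simp add: numeral_eq_Suc)
qed

lemma flag_P10: "flag (algebra_of P10) 4 UNIV"
proof -
  have f1: "flag (algebra_of P10) (Suc 0) matrices_diag2"
    by (rule flag_coord_fst[OF flag_one, where i = 1 and j = 1 and k = 2 and r = "1" and g = "mat2 1 0 0 2"])
      (auto simp: flag_simps field_simps)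
  have f2: "flag (algebra_of P10) (Suc (Suc 0)) matrices_diag"
    by (rule flag_coord_snd[OF f1, where i = 1 and j = 1 and k = 1 and r = "1" and g = "mat2 2 0 0 1"])
      (auto simp: flag_simps field_simps)
  have f3: "flag (algebra_of P10) (Suc (Suc (Suc 0))) matrices_lower"
    by (rule flag_coord_snd[OF f2, where i = 1 and j = 1 and k = 2 and r = "0" and g = "mat2 1 0 1 1"])
      (auto simp: flag_simps field_simps)
  have "flag (algebra_of P10) (Suc (Suc (Suc (Suc 0)))) UNIV"
    by (rule flag_coord_fst[OF f3, where i = 1 and j = 1 and k = 1 and r = "0" and g = "mat2 1 1 0 1"])
      (auto simp: flag_simps field_simps)
  then show ?thesis by (simp add: numeral_eq_Suc)
qed

text \<open>Lower shears fix \<open>P01\<close>, so \<open>matrices_lower\<close> would add nothing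
  to \<open>matrices_diag\<close> and is skipped.\<close>

lemma flag_P01: "flag (algebra_of P01) 3 UNIV"
proof -
  have f1: "flag (algebra_of P01) (Suc 0) matrices_diag2"
    by (rule flag_coord_snd[OF flag_one, where i = 1 and j = 1 and k = 2 and r = "1" and g = "mat2 1 0 0 2"])
      (auto simp: flag_simps field_simps)
  have f2: "flag (algebra_of P01) (Suc (Suc 0)) matrices_diag"
    by (rule flag_coord_snd[OF f1, where i = 1 and j = 1 and k = 1 and r = "1" and g = "mat2 2 0 0 1"])
      (auto simp: flag_simps field_simps)
  have "flag (algebra_of P01) (Suc (Suc (Suc 0))) UNIV"
    by (rule flag_coord_snd[OF f2, where i = 2 and j = 2 and k = 1 and r = "0" and g = "mat2 1 1 0 1"])
      (auto simp: flag_simps field_simps)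
  then show ?thesis by (simp add: numeral_eq_Suc)
qed

lemma flag_P02: "flag (algebra_of P02) 3 UNIV"
proof -
  have f1: "flag (algebra_of P02) (Suc 0) matrices_diag2"
    by (rule flag_coord_snd[OF flag_one, where i = 1 and j = 1 and k = 2 and r = "1" and g = "mat2 1 0 0 2"])
      (auto simp: flag_simps field_simps)
  have f2: "flag (algebra_of P02) (Suc (Suc 0)) matrices_diag"
    by (rule flag_coord_snd[OF f1, where i = 1 and j = 1 and k = 1 and r = "1" and g = "mat2 2 0 0 1"])
      (auto simp: flag_simps field_simps)
  have "flag (algebra_of P02) (Suc (Suc (Suc 0))) UNIV"
    by (rule flag_coord_snd[OF f2, where i = 2 and j = 2 and k = 1 and r = "0" and g = "mat2 1 1 0 1"])
      (auto simp: flag_simps field_simps)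
  then show ?thesis by (simp add: numeral_eq_Suc)
qed

text \<open>Scaling \<open>e 1\<close> fixes \<open>P04\<close>, so \<open>matrices_diag\<close>
  would add nothing to \<open>matrices_diag2\<close>.\<close>

lemma flag_P04: "flag (algebra_of P04) 3 UNIV"
proof -
  have f1: "flag (algebra_of P04) (Suc 0) matrices_diag2"
    by (rule flag_coord_snd[OF flag_one, where i = 2 and j = 1 and k = 1 and r = "1" and g = "mat2 1 0 0 2"])
      (auto simp: flag_simps field_simps)
  have f2: "flag (algebra_of P04) (Suc (Suc 0)) matrices_lower"
    by (rule flag_coord_snd[OF f1, where i = 2 and j = 1 and k = 2 and r = "0" and g = "mat2 1 0 1 1"])
      (auto simp: flag_simps field_simps)
  have "flag (algebra_of P04) (Suc (Suc (Suc 0))) UNIV"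
    by (rule flag_coord_snd[OF f2, where i = 2 and j = 2 and k = 1 and r = "0" and g = "mat2 1 1 0 1"])
      (auto simp: flag_simps field_simps)
  then show ?thesis by (simp add: numeral_eq_Suc)
qed

text \<open>Scaling \<open>e 2\<close> fixes the algebra, so the chain starts with
  \<open>matrices_diag1\<close>. The lower shear moves the second coordinate of
  \<open>e 1 \<circ> e 1\<close> to \<open>1 - \<alpha>\<close>.\<close>

lemma flag_P05: assumes "\<alpha> \<noteq> 1" shows "flag (algebra_of (P05 \<alpha>)) 3 UNIV"
proof -
  have f1: "flag (algebra_of (P05 \<alpha>)) (Suc 0) matrices_diag1"
    by (rule flag_coord_snd[OF flag_one, where i = 1 and j = 1 and k = 1 and r = "1" and g = "mat2 2 0 0 1"])
      (use assms in \<open>auto simp: flag_simps field_simps\<close>)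
  have f2: "flag (algebra_of (P05 \<alpha>)) (Suc (Suc 0)) matrices_lower"
    by (rule flag_coord_snd[OF f1, where i = 1 and j = 1 and k = 2 and r = "0" and g = "mat2 1 0 1 1"])
      (use assms in \<open>auto simp: flag_simps field_simps\<close>)
  have "flag (algebra_of (P05 \<alpha>)) (Suc (Suc (Suc 0))) UNIV"
    by (rule flag_coord_snd[OF f2, where i = 2 and j = 2 and k = 1 and r = "0" and g = "mat2 1 1 0 1"])
      (use assms in \<open>auto simp: flag_simps field_simps\<close>)
  then show ?thesis by (simp add: numeral_eq_Suc)
qed

lemma flag_P06: assumes "\<alpha> \<noteq> 0" shows "flag (algebra_of (P06 \<alpha>)) 3 UNIV"
proof -
  have f1: "flag (algebra_of (P06 \<alpha>)) (Suc 0) matrices_diag1"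
    by (rule flag_coord_snd[OF flag_one, where i = 1 and j = 1 and k = 1 and r = "1" and g = "mat2 2 0 0 1"])
      (use assms in \<open>auto simp: flag_simps field_simps\<close>)
  have f2: "flag (algebra_of (P06 \<alpha>)) (Suc (Suc 0)) matrices_lower"
    by (rule flag_coord_snd[OF f1, where i = 1 and j = 1 and k = 2 and r = "0" and g = "mat2 1 0 1 1"])
      (use assms in \<open>auto simp: flag_simps field_simps\<close>)
  have "flag (algebra_of (P06 \<alpha>)) (Suc (Suc (Suc 0))) UNIV"
    by (rule flag_coord_snd[OF f2, where i = 2 and j = 2 and k = 1 and r = "0" and g = "mat2 1 1 0 1"])
      (use assms in \<open>auto simp: flag_simps field_simps\<close>)
  then show ?thesis by (simp add: numeral_eq_Suc)
qed

text \<open>The product is \<open>\<phi>(x) \<phi>(y) v\<close> with \<open>v\<close> in the kernel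
  of the linear form \<open>\<phi>\<close>; one step scales \<open>v\<close>, the other turns the
  kernel.\<close>

lemma flag_P03: "flag (algebra_of P03) 2 UNIV"
proof -
  have f1: "flag (algebra_of P03) (Suc 0) matrices_diag2"
    by (rule flag_coord_snd[OF flag_one, where i = 1 and j = 1 and k = 2 and r = "1" and g = "mat2 1 0 0 2"])
      (auto simp: flag_simps field_simps)
  have "flag (algebra_of P03) (Suc (Suc 0)) UNIV"
    by (rule flag_coord_snd[OF f1, where i = 2 and j = 2 and k = 1 and r = "0" and g = "mat2 1 1 0 1"])
      (auto simp: flag_simps field_simps)
  then show ?thesis by (simp add: numeral_eq_Suc)
qed

lemma flag_P09: "flag (algebra_of (P09 \<alpha>)) 2 UNIV"
proof -
  have f1: "flag (algebra_of (P09 \<alpha>)) (Suc 0) matrices_diag2"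
    by (rule flag_coord_fst[OF flag_one, where i = 1 and j = 1 and k = 2 and r = "1" and g = "mat2 1 0 0 2"])
      (auto simp: flag_simps field_simps)
  have "flag (algebra_of (P09 \<alpha>)) (Suc (Suc 0)) UNIV"
    by (rule flag_coord_fst[OF f1, where i = 2 and j = 2 and k = 1 and r = "0" and g = "mat2 1 1 0 1"])
      (auto simp: flag_simps field_simps)
  then show ?thesis by (simp add: numeral_eq_Suc)
qed

text \<open>The product is \<open>\<phi>(x) y\<close> and the orbit consists of the nonzero linear
  forms \<open>\<phi>\<close>; one step scales \<open>\<phi>\<close>, the other turns its
  kernel.\<close>

lemma flag_P05_1: "flag (algebra_of (P05 1)) 2 UNIV"
proof -
  have f1: "flag (algebra_of (P05 1)) (Suc 0) matrices_diag1"
    by (rule flag_coord_snd[OF flag_one, where i = 1 and j = 1 and k = 1 and r = "1" and g = "mat2 2 0 0 1"])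
      (auto simp: flag_simps field_simps)
  have "flag (algebra_of (P05 1)) (Suc (Suc 0)) UNIV"
    by (rule flag_coord_snd[OF f1, where i = 2 and j = 2 and k = 2 and r = "0" and g = "mat2 1 1 0 1"])
      (auto simp: flag_simps field_simps)
  then show ?thesis by (simp add: numeral_eq_Suc)
qed

lemma flag_P06_0: "flag (algebra_of (P06 0)) 2 UNIV"
proof -
  have f1: "flag (algebra_of (P06 0)) (Suc 0) matrices_diag1"
    by (rule flag_coord_snd[OF flag_one, where i = 1 and j = 1 and k = 1 and r = "1" and g = "mat2 2 0 0 1"])
      (auto simp: flag_simps field_simps)
  have "flag (algebra_of (P06 0)) (Suc (Suc 0)) UNIV"
    by (rule flag_coord_snd[OF f1, where i = 2 and j = 2 and k = 2 and r = "0" and g = "mat2 1 1 0 1"])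
      (auto simp: flag_simps field_simps)
  then show ?thesis by (simp add: numeral_eq_Suc)
qed

section \<open>Normal forms of matrices modulo the stabilizer\<close>

definition affine_fun :: "((nat \<Rightarrow> complex) \<Rightarrow> complex) \<Rightarrow> bool" where
  "affine_fun f \<longleftrightarrow> (\<forall>x k. \<exists>u v. \<forall>t. f (x(k := t)) = u + t * v)"

lemma affine_fun_const: "affine_fun (\<lambda>x. c)"
  unfolding affine_fun_def by (intro allI exI[of _ c] exI[of _ 0]) simp

lemma affine_fun_proj: "affine_fun (\<lambda>x. x n)"
  unfolding affine_fun_def
proof (intro allI)
  fix x :: "nat \<Rightarrow> complex" and k
  show "\<exists>u v. \<forall>t. (x(k := t)) n = u + t * v"
  proof (cases "n = k")
    case True
    then show ?thesis by (intro exI[of _ 0] exI[of _ 1]) simp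
  next
    case False
    then show ?thesis by (intro exI[of _ "x n"] exI[of _ 0]) simp
  qed
qed

lemma affine_parametrization_mat2:
  assumes "affine_fun a" "affine_fun b" "affine_fun c" "affine_fun d"
  shows "affine_parametrization (\<lambda>x. mat2 (a x) (b x) (c x) (d x))"
  unfolding affine_parametrization_def
proof (intro allI)
  fix x :: "nat \<Rightarrow> complex" and k
  obtain a1 a2 b1 b2 c1 c2 d1 d2 where
    "\<And>t. a (x(k := t)) = a1 + t * a2" "\<And>t. b (x(k := t)) = b1 + t * b2"
    "\<And>t. c (x(k := t)) = c1 + t * c2" "\<And>t. d (x(k := t)) = d1 + t * d2"
    using assms unfolding affine_fun_def by metis
  then show "\<exists>g h. \<forall>t. mat2 (a (x(k := t))) (b (x(k := t))) (c (x(k := t))) (d (x(k := t))) = line g h t"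
    by (intro exI[of _ "mat2 a1 b1 c1 d1"] exI[of _ "mat2 a2 b2 c2 d2"])
      (simp add: line_def vec_eq_iff forall_2 mat2_nth)
qed

lemmas affine_intros = affine_parametrization_mat2 affine_fun_const affine_fun_proj

lemma mat2_mult:
  "g ** mat2 a b c d = mat2 (g $ 1 $ 1 * a + g $ 1 $ 2 * c) (g $ 1 $ 1 * b + g $ 1 $ 2 * d)
     (g $ 2 $ 1 * a + g $ 2 $ 2 * c) (g $ 2 $ 1 * b + g $ 2 $ 2 * d)"
  by (simp add: vec_eq_iff forall_2 matrix_matrix_mult_def sum_2 mat2_nth)

definition vec_upto4 :: "complex \<Rightarrow> complex \<Rightarrow> complex \<Rightarrow> complex \<Rightarrow> nat \<Rightarrow> complex" where
  "vec_upto4 a b c d i = (if i = 0 then a else if i = 1 then b else if i = 2 then c else if i = 3 then d else 0)"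

lemma orbit_dim_eqI4:
  assumes "A \<in> bil_pairs" "flag A 4 L"
  shows "orbit_dim A = 4"
proof -
  let ?l = "\<lambda>x :: nat \<Rightarrow> complex. mat2 (x 0) (x 1) (x 2) (x 3)"
  have l: "affine_parametrization ?l" by (intro affine_intros)
  have "\<exists>s x. det s \<noteq> 0 \<and> act s A = A \<and> (\<forall>i\<ge>4. x i = 0) \<and> (g ** s = ?l x \<or> g ** s = ?l x)" for g
    by (rule exI[of _ "mat 1"], rule exI[of _ "vec_upto4 (g $ 1 $ 1) (g $ 1 $ 2) (g $ 2 $ 1) (g $ 2 $ 2)"])
      (simp add: act_mat_1 vec_upto4_def vec_eq_iff forall_2 mat2_nth)
  then show ?thesis
    using orbit_dim_eqI[OF assms l l] by (simp add: numeral_eq_enat)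
qed

text \<open>The stabilizer scales the second column of \<open>g\<close>: a nonzero entry there
  becomes 1, the other three entries of the matrix are parameters.\<close>

lemma orbit_dim_eqI3_diag2:
  assumes A: "A \<in> bil_pairs" "flag A 3 L" and stab: "\<And>s. s \<noteq> 0 \<Longrightarrow> act (mat2 1 0 0 s) A = A"
  shows "orbit_dim A = 3"
proof -
  let ?l = "\<lambda>x :: nat \<Rightarrow> complex. mat2 (x 0) 1 (x 1) (x 2)" and ?l' = "\<lambda>x :: nat \<Rightarrow> complex. mat2 (x 0) (x 2) (x 1) 1"
  have l: "affine_parametrization ?l" "affine_parametrization ?l'" by (intro affine_intros)+
  have "orbit_dim A = enat 3"
  proof (rule orbit_dim_eqI[OF A l])
    fix g :: "complex^2^2" assume g: "det g \<noteq> 0"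
    define s where "s = (if g $ 1 $ 2 \<noteq> 0 then 1 / g $ 1 $ 2 else 1 / g $ 2 $ 2)"
    have s: "s \<noteq> 0" "g $ 1 $ 2 * s = 1 \<or> g $ 2 $ 2 * s = 1" using g by (auto simp: s_def det_2)
    let ?x = "vec_upto4 (g $ 1 $ 1) (g $ 2 $ 1) (if g $ 1 $ 2 * s = 1 then g $ 2 $ 2 * s else g $ 1 $ 2 * s) 0"
    show "\<exists>s x. det s \<noteq> 0 \<and> act s A = A \<and> (\<forall>i\<ge>3. x i = 0) \<and> (g ** s = ?l x \<or> g ** s = ?l' x)"
      by (rule exI[of _ "mat2 1 0 0 s"], rule exI[of _ ?x])
        (use s stab in \<open>auto simp: det_mat2 vec_upto4_def mat2_mult\<close>)
  qed
  then show ?thesis by (simp add: numeral_eq_enat)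
qed

lemma orbit_dim_eqI3_diag1:
  assumes A: "A \<in> bil_pairs" "flag A 3 L" and stab: "\<And>s. s \<noteq> 0 \<Longrightarrow> act (mat2 s 0 0 1) A = A"
  shows "orbit_dim A = 3"
proof -
  let ?l = "\<lambda>x :: nat \<Rightarrow> complex. mat2 1 (x 0) (x 1) (x 2)" and ?l' = "\<lambda>x :: nat \<Rightarrow> complex. mat2 (x 1) (x 0) 1 (x 2)"
  have l: "affine_parametrization ?l" "affine_parametrization ?l'" by (intro affine_intros)+
  have "orbit_dim A = enat 3"
  proof (rule orbit_dim_eqI[OF A l])
    fix g :: "complex^2^2" assume g: "det g \<noteq> 0"
    define s where "s = (if g $ 1 $ 1 \<noteq> 0 then 1 / g $ 1 $ 1 else 1 / g $ 2 $ 1)"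
    have s: "s \<noteq> 0" "g $ 1 $ 1 * s = 1 \<or> g $ 2 $ 1 * s = 1" using g by (auto simp: s_def det_2)
    let ?x = "vec_upto4 (g $ 1 $ 2) (if g $ 1 $ 1 * s = 1 then g $ 2 $ 1 * s else g $ 1 $ 1 * s) (g $ 2 $ 2) 0"
    show "\<exists>s x. det s \<noteq> 0 \<and> act s A = A \<and> (\<forall>i\<ge>3. x i = 0) \<and> (g ** s = ?l x \<or> g ** s = ?l' x)"
      by (rule exI[of _ "mat2 s 0 0 1"], rule exI[of _ ?x])
        (use s stab in \<open>auto simp: det_mat2 vec_upto4_def mat2_mult\<close>)
  qed
  then show ?thesis by (simp add: numeral_eq_enat)
qed

text \<open>The stabilizer adds multiples of the second column of \<open>g\<close> to the first, so
  one entry of the first column can be made 0.\<close>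

lemma orbit_dim_eqI3_shear:
  assumes A: "A \<in> bil_pairs" "flag A 3 L" and stab: "\<And>s. act (mat2 1 0 s 1) A = A"
  shows "orbit_dim A = 3"
proof -
  let ?l = "\<lambda>x :: nat \<Rightarrow> complex. mat2 0 (x 0) (x 1) (x 2)" and ?l' = "\<lambda>x :: nat \<Rightarrow> complex. mat2 (x 1) (x 0) 0 (x 2)"
  have l: "affine_parametrization ?l" "affine_parametrization ?l'" by (intro affine_intros)+
  have "orbit_dim A = enat 3"
  proof (rule orbit_dim_eqI[OF A l])
    fix g :: "complex^2^2" assume g: "det g \<noteq> 0"
    define s where "s = (if g $ 1 $ 2 \<noteq> 0 then - g $ 1 $ 1 / g $ 1 $ 2 else - g $ 2 $ 1 / g $ 2 $ 2)"
    let ?u = "g $ 1 $ 1 + g $ 1 $ 2 * s" and ?v = "g $ 2 $ 1 + g $ 2 $ 2 * s"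
    have s: "?u = 0 \<or> ?v = 0" using g by (auto simp: s_def det_2)
    let ?x = "vec_upto4 (g $ 1 $ 2) (if ?u = 0 then ?v else ?u) (g $ 2 $ 2) 0"
    show "\<exists>s x. det s \<noteq> 0 \<and> act s A = A \<and> (\<forall>i\<ge>3. x i = 0) \<and> (g ** s = ?l x \<or> g ** s = ?l' x)"
      by (rule exI[of _ "mat2 1 0 s 1"], rule exI[of _ ?x])
        (use s stab in \<open>auto simp: det_mat2 vec_upto4_def mat2_mult\<close>)
  qed
  then show ?thesis by (simp add: numeral_eq_enat)
qed

lemma orbit_dim_eqI2_square:
  assumes A: "A \<in> bil_pairs" "flag A 2 L" and stab: "\<And>r s. r \<noteq> 0 \<Longrightarrow> act (mat2 r 0 s (r\<^sup>2)) A = A"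
  shows "orbit_dim A = 2"
proof -
  let ?l = "\<lambda>x :: nat \<Rightarrow> complex. mat2 0 (x 0) 1 (x 1)" and ?l' = "\<lambda>x :: nat \<Rightarrow> complex. mat2 1 0 0 (x 1)"
  have l: "affine_parametrization ?l" "affine_parametrization ?l'" by (intro affine_intros)+
  have "orbit_dim A = enat 2"
  proof (rule orbit_dim_eqI[OF A l])
    fix g :: "complex^2^2" assume g: "det g \<noteq> 0"
    \<comment> \<open>If the upper right entry is nonzero, \<open>r\<close> and \<open>s\<close>
      turn the first column into (0, 1). Otherwise they turn it into (1, 0), and the second column
      keeps its zero.\<close>
    define r where "r = (if g $ 1 $ 2 \<noteq> 0 then - g $ 1 $ 2 / det g else 1 / g $ 1 $ 1)"
    define s where "s = (if g $ 1 $ 2 \<noteq> 0 then - g $ 1 $ 1 * r / g $ 1 $ 2 else - g $ 2 $ 1 * r / g $ 2 $ 2)"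
    have r: "r \<noteq> 0" using g by (auto simp: r_def det_2)
    have eq: "g $ 1 $ 1 * r + g $ 1 $ 2 * s = 0 \<and> g $ 2 $ 1 * r + g $ 2 $ 2 * s = 1 \<or>
        g $ 1 $ 2 = 0 \<and> g $ 1 $ 1 * r + g $ 1 $ 2 * s = 1 \<and> g $ 2 $ 1 * r + g $ 2 $ 2 * s = 0"
    proof (cases "g $ 1 $ 2 = 0")
      case True
      then show ?thesis using g by (auto simp: r_def s_def det_2)
    next
      case False
      have "g $ 2 $ 1 * r + g $ 2 $ 2 * s = - r * det g / g $ 1 $ 2"
        using False by (simp add: s_def det_2 field_simps)
      also have "\<dots> = 1" using False g by (simp add: r_def)
      finally show ?thesis using False by (simp add: s_def)
    qed
    let ?x = "vec_upto4 (g $ 1 $ 2 * r\<^sup>2) (g $ 2 $ 2 * r\<^sup>2) 0 0"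
    show "\<exists>s x. det s \<noteq> 0 \<and> act s A = A \<and> (\<forall>i\<ge>2. x i = 0) \<and> (g ** s = ?l x \<or> g ** s = ?l' x)"
      by (rule exI[of _ "mat2 r 0 s (r\<^sup>2)"], rule exI[of _ ?x])
        (use r eq stab in \<open>auto simp: det_mat2 vec_upto4_def mat2_mult\<close>)
  qed
  then show ?thesis by (simp add: numeral_eq_enat)
qed

text \<open>The stabilizer scales the second column and shifts the first along it. A nonzero upper
  right entry becomes 1 and clears the entry to its left; if it is zero, the lower right entry does
  the same.\<close>

lemma orbit_dim_eqI2_affine:
  assumes A: "A \<in> bil_pairs" "flag A 2 L" and stab: "\<And>r s. r \<noteq> 0 \<Longrightarrow> act (mat2 1 0 s r) A = A"
  shows "orbit_dim A = 2"
proof -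
  let ?l = "\<lambda>x :: nat \<Rightarrow> complex. mat2 0 1 (x 0) (x 1)" and ?l' = "\<lambda>x :: nat \<Rightarrow> complex. mat2 (x 0) 0 0 1"
  have l: "affine_parametrization ?l" "affine_parametrization ?l'" by (intro affine_intros)+
  have "orbit_dim A = enat 2"
  proof (rule orbit_dim_eqI[OF A l])
    fix g :: "complex^2^2" assume g: "det g \<noteq> 0"
    define r where "r = (if g $ 1 $ 2 \<noteq> 0 then 1 / g $ 1 $ 2 else 1 / g $ 2 $ 2)"
    define s where "s = (if g $ 1 $ 2 \<noteq> 0 then - g $ 1 $ 1 / g $ 1 $ 2 else - g $ 2 $ 1 / g $ 2 $ 2)"
    have r: "r \<noteq> 0" using g by (auto simp: r_def det_2)
    have eq: "g $ 1 $ 1 + g $ 1 $ 2 * s = 0 \<and> g $ 1 $ 2 * r = 1 \<or>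
        g $ 1 $ 2 = 0 \<and> g $ 2 $ 1 + g $ 2 $ 2 * s = 0 \<and> g $ 2 $ 2 * r = 1"
      using g by (auto simp: r_def s_def det_2)
    let ?x = "if g $ 1 $ 2 = 0 then vec_upto4 (g $ 1 $ 1) 0 0 0
      else vec_upto4 (g $ 2 $ 1 + g $ 2 $ 2 * s) (g $ 2 $ 2 * r) 0 0"
    show "\<exists>s x. det s \<noteq> 0 \<and> act s A = A \<and> (\<forall>i\<ge>2. x i = 0) \<and> (g ** s = ?l x \<or> g ** s = ?l' x)"
      by (rule exI[of _ "mat2 1 0 s r"], rule exI[of _ ?x])
        (use r eq stab in \<open>auto simp: det_mat2 vec_upto4_def mat2_mult\<close>)
  qed
  then show ?thesis by (simp add: numeral_eq_enat)
qed

lemma orbit_dim_algebra_of: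
  shows "orbit_dim (algebra_of P07) = 4" "orbit_dim (algebra_of P08) = 4" "orbit_dim (algebra_of P10) = 4"
    and "orbit_dim (algebra_of P01) = 3" "orbit_dim (algebra_of P02) = 3" "orbit_dim (algebra_of P04) = 3"
    and "\<alpha> \<noteq> 1 \<Longrightarrow> orbit_dim (algebra_of (P05 \<alpha>)) = 3" "\<alpha> \<noteq> 0 \<Longrightarrow> orbit_dim (algebra_of (P06 \<alpha>)) = 3"
    and "orbit_dim (algebra_of P03) = 2" "orbit_dim (algebra_of (P05 1)) = 2"
      "orbit_dim (algebra_of (P06 0)) = 2" "orbit_dim (algebra_of (P09 \<alpha>)) = 2"
    and "orbit_dim (algebra_of C8) = 0"
proof -
  note simps = act_eq_iff invertible_det_nz det_mat2 vec_eq_iff forall_2 matrix_vector_mult_2 mat2_nth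
    table_nth e_nth
  note b = algebra_of_bil_pairs
  show "orbit_dim (algebra_of P07) = 4" "orbit_dim (algebra_of P08) = 4" "orbit_dim (algebra_of P10) = 4"
    by (rule orbit_dim_eqI4[OF b], rule flag_P07 flag_P08 flag_P10)+
  show "orbit_dim (algebra_of P01) = 3"
    by (rule orbit_dim_eqI3_shear[OF b flag_P01]) (auto simp: simps algebra_simps power2_eq_square)
  show "orbit_dim (algebra_of P02) = 3"
    by (rule orbit_dim_eqI3_shear[OF b flag_P02]) (auto simp: simps algebra_simps power2_eq_square)
  show "orbit_dim (algebra_of P04) = 3"
    by (rule orbit_dim_eqI3_diag1[OF b flag_P04]) (auto simp: simps algebra_simps)
  show "orbit_dim (algebra_of (P05 \<alpha>)) = 3" if "\<alpha> \<noteq> 1"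
    by (rule orbit_dim_eqI3_diag2[OF b flag_P05[OF that]]) (auto simp: simps algebra_simps)
  show "orbit_dim (algebra_of (P06 \<alpha>)) = 3" if "\<alpha> \<noteq> 0"
    by (rule orbit_dim_eqI3_diag2[OF b flag_P06[OF that]]) (auto simp: simps algebra_simps)
  show "orbit_dim (algebra_of P03) = 2"
    by (rule orbit_dim_eqI2_square[OF b flag_P03]) (auto simp: simps algebra_simps power2_eq_square)
  show "orbit_dim (algebra_of (P09 \<alpha>)) = 2"
    by (rule orbit_dim_eqI2_square[OF b flag_P09]) (auto simp: simps algebra_simps power2_eq_square)
  show "orbit_dim (algebra_of (P05 1)) = 2"
    by (rule orbit_dim_eqI2_affine[OF b flag_P05_1]) (auto simp: simps algebra_simps power2_eq_square)
  show "orbit_dim (algebra_of (P06 0)) = 2"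
    by (rule orbit_dim_eqI2_affine[OF b flag_P06_0]) (auto simp: simps algebra_simps power2_eq_square)
  let ?l = "\<lambda>x :: nat \<Rightarrow> complex. mat2 1 0 0 1"
  have l: "affine_parametrization ?l" by (intro affine_intros)
  have "orbit_dim (algebra_of C8) = enat 0"
  proof (rule orbit_dim_eqI[OF b flag_one l l])
    fix g :: "complex^2^2" assume g: "det g \<noteq> 0"
    \<comment> \<open>Every invertible matrix fixes the zero algebra, so \<open>g\<close> is simply
      multiplied by its inverse.\<close>
    obtain h where h: "g ** h = mat 1" "h ** g = mat 1"
      using g unfolding invertible_det_nz[symmetric] invertible_def by blast
    then have "invertible h" unfolding invertible_def by blast
    moreover have "mat 1 = mat2 1 0 0 1" by (simp add: vec_eq_iff forall_2 mat2_nth mat_def)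
    ultimately show "\<exists>s x. det s \<noteq> 0 \<and> act s (algebra_of C8) = algebra_of C8 \<and>
        (\<forall>i\<ge>0. x i = 0) \<and> (g ** s = ?l x \<or> g ** s = ?l x)"
      using h by (intro exI[of _ h] exI[of _ "\<lambda>_. 0"]) (simp add: simps)
  qed
  then show "orbit_dim (algebra_of C8) = 0" by (simp add: zero_enat_def)
qed

section \<open>Invariants of the pre-Lie product\<close>

definition left_mult :: "product \<times> product \<Rightarrow> V \<Rightarrow> complex^2^2" where
  "left_mult A x = (\<chi> k l. \<Sum>j\<in>UNIV. x $ j * snd A (e j) (e l) $ k)"

definition right_mult :: "product \<times> product \<Rightarrow> V \<Rightarrow> complex^2^2" where
  "right_mult A y = (\<chi> k l. \<Sum>j\<in>UNIV. y $ j * snd A (e l) (e j) $ k)"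

lemma mult_matrices_eq:
  assumes "A \<in> bil_pairs"
  shows "left_mult A x *v y = snd A x y" "right_mult A y *v x = snd A x y"
proof -
  obtain a b c d where "snd A = table a b c d"
    using assms bilinear_map_eq_table[of "snd A"] by (auto simp: bil_pairs_def)
  then show "left_mult A x *v y = snd A x y" "right_mult A y *v x = snd A x y"
    by (simp_all add: vec_eq_iff matrix_vector_mult_2 left_mult_def right_mult_def sum_2 table_nth e_nth
        algebra_simps)
qed

text \<open>Base change conjugates the operators of \<open>matrix_inv g *v x\<close> into those of
  \<open>x\<close>. Relations between traces and determinants demanded for all \<open>x\<close>
  therefore pass to the whole orbit.\<close>

lemma mult_matrices_act:
  assumes A: "A \<in> bil_pairs" and g: "invertible g"
  shows "left_mult (act g A) x = g ** left_mult A (matrix_inv g *v x) ** matrix_inv g"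
    and "right_mult (act g A) x = g ** right_mult A (matrix_inv g *v x) ** matrix_inv g"
proof -
  have "left_mult (act g A) x *v y = (g ** left_mult A (matrix_inv g *v x) ** matrix_inv g) *v y"
    "right_mult (act g A) x *v y = (g ** right_mult A (matrix_inv g *v x) ** matrix_inv g) *v y" for y
    by (simp_all add: mult_matrices_eq[OF act_bil_pairs[OF A]] mult_matrices_eq[OF A]
        matrix_vector_mul_assoc[symmetric]) (simp_all add: act_def case_prod_unfold)
  then show "left_mult (act g A) x = g ** left_mult A (matrix_inv g *v x) ** matrix_inv g"
    "right_mult (act g A) x = g ** right_mult A (matrix_inv g *v x) ** matrix_inv g"
    by (simp_all add: matrix_eq)
qed

lemma trace_det_conj:
  fixes g M :: "complex^2^2"
  assumes g: "invertible g"
  shows "trace (g ** M ** matrix_inv g) = trace M" "det (g ** M ** matrix_inv g) = det M"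
proof -
  have "trace (g ** M ** matrix_inv g) = trace (matrix_inv g ** (g ** M))"
    by (rule trace_mul_sym)
  then show "trace (g ** M ** matrix_inv g) = trace M"
    using matrix_inv_cancel(2)[OF g] by (simp add: matrix_mul_assoc)
  have "det (g ** M ** matrix_inv g) = det (g ** matrix_inv g) * det M"
    by (simp add: det_mul)
  then show "det (g ** M ** matrix_inv g) = det M"
    using matrix_inv_cancel(1)[OF g] by simp
qed

lemma polynomial_fun_trace_det:
  "polynomial_fun (\<lambda>A. trace (left_mult A x))" "polynomial_fun (\<lambda>A. trace (right_mult A x))"
  "polynomial_fun (\<lambda>A. det (right_mult A x))"
  unfolding trace_def det_2 left_mult_def right_mult_def vec_lambda_beta
  by (intro polynomial_fun_intros)+

text \<open>Two coefficients rather than a ratio, so that the vanishing of a single trace is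
  included.\<close>

lemma degenerates_trace_relation:
  assumes A: "A \<in> bil_pairs" and AB: "degenerates A B"
    and rel: "\<And>x. c * trace (left_mult A x) = d * trace (right_mult A x)"
  shows "c * trace (left_mult B x) = d * trace (right_mult B x)"
proof -
  have "c * trace (left_mult B x) - d * trace (right_mult B x) = 0"
    by (rule degenerates_imp_polynomial_zero[OF A AB,
          of "\<lambda>A. c * trace (left_mult A x) - d * trace (right_mult A x)"])
      (auto intro!: polynomial_fun_diff polynomial_fun.mult polynomial_fun.const polynomial_fun_trace_det
        simp: mult_matrices_act[OF A] trace_det_conj invertible_det_nz[symmetric] rel)
  then show ?thesis by simp
qed

lemma degenerates_det_relation:
  assumes A: "A \<in> bil_pairs" and AB: "degenerates A B"
    and rel: "\<And>x. det (right_mult A x) = c * trace (right_mult A x) ^ 2"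
  shows "det (right_mult B x) = c * trace (right_mult B x) ^ 2"
proof -
  have "det (right_mult B x) - c * trace (right_mult B x) ^ 2 = 0"
    by (rule degenerates_imp_polynomial_zero[OF A AB,
          of "\<lambda>A. det (right_mult A x) - c * trace (right_mult A x) ^ 2"])
      (auto intro!: polynomial_fun_diff polynomial_fun_power polynomial_fun.mult polynomial_fun.const
        polynomial_fun_trace_det
        simp: mult_matrices_act[OF A] trace_det_conj invertible_det_nz[symmetric] rel)
  then show ?thesis by simp
qed

text \<open>A linear relation between the two products does not depend on the basis. It keeps a zero
  first product zero and fixes the parameter of \<open>P09\<close>.\<close>

lemma degenerates_coordinate_relation:
  assumes A: "A \<in> bil_pairs" and AB: "degenerates A B"
    and rel: "\<And>x y. c *s fst A x y = d *s snd A x y"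
  shows "c * fst B (e i) (e j) $ k = d * snd B (e i) (e j) $ k"
proof -
  have "c *s fst (act g A) x y = d *s snd (act g A) x y" for g x y
    using rel by (simp add: act_def case_prod_unfold vector_scalar_commute[symmetric])
  then have "c * fst (act g A) x y $ k = d * snd (act g A) x y $ k" for g x y
    by (metis vector_smult_component)
  then have "c * fst B (e i) (e j) $ k - d * snd B (e i) (e j) $ k = 0"
    by (intro degenerates_imp_polynomial_zero[OF A AB,
          of "\<lambda>A. c * fst A (e i) (e j) $ k - d * snd A (e i) (e j) $ k"]
        polynomial_fun_diff polynomial_fun.mult polynomial_fun.const polynomial_fun.coord_fst
        polynomial_fun.coord_snd) simp
  then show ?thesis by simp
qed

lemma degenerates_snd_coordinate_zero:
  assumes "A \<in> bil_pairs" "degenerates A B"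
    and "\<And>g. det g \<noteq> 0 \<Longrightarrow> snd (act g A) (e i) (e j) $ k = 0"
  shows "snd B (e i) (e j) $ k = 0"
  by (rule degenerates_imp_polynomial_zero[OF assms(1,2) polynomial_fun.coord_snd assms(3)])

lemmas invariant_simps = left_mult_def right_mult_def trace_def sum_2 det_2 table_nth e_nth

section \<open>Possible targets of each algebra\<close>

lemma degenerates_fst_zero:
  assumes "degenerates (algebra_of T) (algebra_of T')"
    and "fst (algebra_of T) = table 0 0 0 0"
  shows "(\<forall>\<alpha>. T' \<noteq> P09 \<alpha>) \<and> T' \<noteq> P10"
proof -
  have "1 * fst (algebra_of T') (e 1) (e 1) $ 2 = 0 * snd (algebra_of T') (e 1) (e 1) $ 2"
    by (rule degenerates_coordinate_relation[OF algebra_of_bil_pairs assms(1)])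
      (simp add: assms(2) vec_eq_iff table_nth)
  then show ?thesis by (auto simp: table_nth e_nth)
qed

lemma degenerates_traces:
  assumes "degenerates (algebra_of T) (algebra_of T')"
    and "\<And>x. c * trace (left_mult (algebra_of T) x) = d * trace (right_mult (algebra_of T) x)"
  shows "c * trace (left_mult (algebra_of T') (e 1)) = d * trace (right_mult (algebra_of T') (e 1))"
    and "c * trace (left_mult (algebra_of T') (e 2)) = d * trace (right_mult (algebra_of T') (e 2))"
  by (rule degenerates_trace_relation[OF algebra_of_bil_pairs assms])+

text \<open>The basis vectors do not suffice: in \<open>P07\<close> both have singular right
  multiplication, and only \<open>e 1 + e 2\<close> shows that \<open>P05 0\<close> does not reach
  \<open>P07\<close>.\<close>

lemma degenerates_dets:
  assumes "degenerates (algebra_of T) (algebra_of T')"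
    and "\<And>x. det (right_mult (algebra_of T) x) = c * trace (right_mult (algebra_of T) x) ^ 2"
  shows "det (right_mult (algebra_of T') (e 1)) = c * trace (right_mult (algebra_of T') (e 1)) ^ 2"
    and "det (right_mult (algebra_of T') (e 2)) = c * trace (right_mult (algebra_of T') (e 2)) ^ 2"
    and "det (right_mult (algebra_of T') (e 1 + e 2)) = c * trace (right_mult (algebra_of T') (e 1 + e 2)) ^ 2"
  by (rule degenerates_det_relation[OF algebra_of_bil_pairs assms])+

lemma degenerates_from_P07:
  assumes "degenerates (algebra_of P07) (algebra_of T')"
  shows "T' \<in> {P07, P05 0, P06 1, P03, C8}"
proof -
  have tr: "1 * trace (left_mult (algebra_of P07) x) = 1 * trace (right_mult (algebra_of P07) x)" for x
    by (simp add: invariant_simps algebra_simps)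
  show ?thesis
    using degenerates_fst_zero[OF assms] degenerates_traces[OF assms tr]
    by (cases T') (auto simp: invariant_simps field_simps power2_eq_square)
qed

lemma degenerates_from_P08:
  assumes "degenerates (algebra_of P08) (algebra_of T')"
  shows "T' \<in> {P08, P05 (1/2), P06 2, P03, C8}"
proof -
  \<comment> \<open>The ratio 3/2 equals \<open>1 + \<alpha>\<close> in \<open>P05 (1/2)\<close> and
    \<open>(1 + \<alpha>) / 2\<close> in \<open>P06 2\<close>.\<close>
  have tr: "2 * trace (left_mult (algebra_of P08) x) = 3 * trace (right_mult (algebra_of P08) x)" for x
    by (simp add: invariant_simps algebra_simps)
  show ?thesis
    using degenerates_fst_zero[OF assms] degenerates_traces[OF assms tr]
    by (cases T') (auto simp: invariant_simps field_simps power2_eq_square)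
qed

lemma degenerates_from_P10:
  assumes "degenerates (algebra_of P10) (algebra_of T')"
  shows "T' \<in> {P10, P06 1, P03, C8} \<union> range P09"
proof -
  have tr: "1 * trace (left_mult (algebra_of P10) x) = 1 * trace (right_mult (algebra_of P10) x)" for x
    by (simp add: invariant_simps algebra_simps)
  have dt: "det (right_mult (algebra_of P10) x) = (1/4) * trace (right_mult (algebra_of P10) x) ^ 2" for x
    by (simp add: invariant_simps power2_eq_square algebra_simps)
  show ?thesis
    using degenerates_traces[OF assms tr] degenerates_dets[OF assms dt]
    by (cases T') (auto simp: invariant_simps field_simps power2_eq_square)
qed

lemma degenerates_from_P01:
  assumes "degenerates (algebra_of P01) (algebra_of T')"
  shows "T' \<in> {P01, P06 0, P03, C8}"
proof -
  have tr: "2 * trace (left_mult (algebra_of P01) x) = 1 * trace (right_mult (algebra_of P01) x)" for x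
    by (simp add: invariant_simps algebra_simps)
  have dt: "det (right_mult (algebra_of P01) x) = (1/4) * trace (right_mult (algebra_of P01) x) ^ 2" for x
    by (simp add: invariant_simps power2_eq_square algebra_simps)
  show ?thesis
    using degenerates_fst_zero[OF assms] degenerates_traces[OF assms tr] degenerates_dets[OF assms dt]
    by (cases T') (auto simp: invariant_simps field_simps power2_eq_square)
qed

lemma degenerates_from_P02:
  assumes "degenerates (algebra_of P02) (algebra_of T')"
  shows "T' \<in> {P02, P05 1, P03, C8}"
proof -
  have tr: "1 * trace (left_mult (algebra_of P02) x) = 2 * trace (right_mult (algebra_of P02) x)" for x
    by (simp add: invariant_simps algebra_simps)
  have dt: "det (right_mult (algebra_of P02) x) = 0 * trace (right_mult (algebra_of P02) x) ^ 2" for x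
    by (simp add: invariant_simps power2_eq_square algebra_simps)
  show ?thesis
    using degenerates_fst_zero[OF assms] degenerates_traces[OF assms tr] degenerates_dets[OF assms dt]
    by (cases T') (auto simp: invariant_simps field_simps power2_eq_square)
qed

lemma degenerates_from_P04:
  assumes "degenerates (algebra_of P04) (algebra_of T')"
  shows "T' \<in> {P04, P03, C8}"
proof -
  \<comment> \<open>All right multiplications of \<open>P04\<close> have trace zero.\<close>
  have tr: "0 * trace (left_mult (algebra_of P04) x) = 1 * trace (right_mult (algebra_of P04) x)" for x
    by (simp add: invariant_simps algebra_simps)
  show ?thesis
    using degenerates_fst_zero[OF assms] degenerates_traces[OF assms tr]
    by (cases T') (auto simp: invariant_simps field_simps power2_eq_square)
qed

lemma degenerates_from_P05:
  assumes "degenerates (algebra_of (P05 \<alpha>)) (algebra_of T')"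
  shows "T' \<in> {P05 \<alpha>, P03, C8} \<or> \<alpha> = 1 \<and> T' = P02"
proof -
  have tr: "1 * trace (left_mult (algebra_of (P05 \<alpha>)) x) = (1 + \<alpha>) * trace (right_mult (algebra_of (P05 \<alpha>)) x)" for x
    by (simp add: invariant_simps algebra_simps)
  \<comment> \<open>Right multiplications of \<open>P05\<close> kill \<open>e 2\<close>.\<close>
  have dt: "det (right_mult (algebra_of (P05 \<alpha>)) x) = 0 * trace (right_mult (algebra_of (P05 \<alpha>)) x) ^ 2" for x
    by (simp add: invariant_simps power2_eq_square algebra_simps)
  show ?thesis
    using degenerates_fst_zero[OF assms] degenerates_traces[OF assms tr] degenerates_dets[OF assms dt]
    by (cases T') (auto simp: invariant_simps field_simps power2_eq_square)
qed

text \<open>All squares are multiples of their argument, so \<open>e 1 \<circ> e 1\<close> stays on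
  the first axis in every basis; this excludes \<open>P02\<close> and \<open>P03\<close>.\<close>

lemma degenerates_from_P05_1:
  assumes "degenerates (algebra_of (P05 1)) (algebra_of T')"
  shows "T' \<in> {P05 1, C8}"
proof -
  have "snd (algebra_of T') (e 1) (e 1) $ 2 = 0"
    by (rule degenerates_snd_coordinate_zero[OF algebra_of_bil_pairs assms])
      (auto simp: act_coord det_2 field_simps)
  then show ?thesis using degenerates_from_P05[OF assms] by (auto simp: table_nth e_nth)
qed

lemma degenerates_from_P06:
  assumes "degenerates (algebra_of (P06 \<alpha>)) (algebra_of T')"
  shows "T' \<in> {P06 \<alpha>, P03, C8} \<or> \<alpha> = 0 \<and> T' = P01"
proof -
  have tr: "2 * trace (left_mult (algebra_of (P06 \<alpha>)) x) = (1 + \<alpha>) * trace (right_mult (algebra_of (P06 \<alpha>)) x)" for x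
    by (simp add: invariant_simps algebra_simps)
  \<comment> \<open>Right multiplications of \<open>P06\<close> are a scalar plus a nilpotent
    matrix, so they have a double eigenvalue.\<close>
  have dt: "det (right_mult (algebra_of (P06 \<alpha>)) x) = (1/4) * trace (right_mult (algebra_of (P06 \<alpha>)) x) ^ 2" for x
    by (simp add: invariant_simps power2_eq_square algebra_simps)
  show ?thesis
    using degenerates_fst_zero[OF assms] degenerates_traces[OF assms tr] degenerates_dets[OF assms dt]
    by (cases T') (auto simp: invariant_simps field_simps power2_eq_square)
qed

lemma degenerates_from_P06_0:
  assumes "degenerates (algebra_of (P06 0)) (algebra_of T')"
  shows "T' \<in> {P06 0, C8}"
proof -
  have "snd (algebra_of T') (e 1) (e 1) $ 2 = 0"
    by (rule degenerates_snd_coordinate_zero[OF algebra_of_bil_pairs assms])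
      (auto simp: act_coord det_2 field_simps)
  then show ?thesis using degenerates_from_P06[OF assms] by (auto simp: table_nth e_nth)
qed

lemma degenerates_from_P03:
  assumes "degenerates (algebra_of P03) (algebra_of T')"
  shows "T' \<in> {P03, C8}"
proof -
  have tr0: "0 * trace (left_mult (algebra_of P03) x) = 1 * trace (right_mult (algebra_of P03) x)" for x
    by (simp add: invariant_simps algebra_simps)
  have tr1: "1 * trace (left_mult (algebra_of P03) x) = 0 * trace (right_mult (algebra_of P03) x)" for x
    by (simp add: invariant_simps algebra_simps)
  show ?thesis
    using degenerates_fst_zero[OF assms] degenerates_traces[OF assms tr0] degenerates_traces[OF assms tr1]
    by (cases T') (auto simp: invariant_simps field_simps power2_eq_square)
qed

lemma degenerates_from_P09:
  assumes "degenerates (algebra_of (P09 \<alpha>)) (algebra_of T')"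
  shows "T' \<in> {P09 \<alpha>, C8}"
proof -
  have "\<alpha> * fst (algebra_of T') (e i) (e j) $ k = 1 * snd (algebra_of T') (e i) (e j) $ k" for i j k
    by (rule degenerates_coordinate_relation[OF algebra_of_bil_pairs assms])
      (simp add: vec_eq_iff table_nth)
  from this[of 1 1 1] this[of 1 1 2] this[of 2 1 1] show ?thesis
    by (cases T') (auto simp: table_nth e_nth)
qed

lemma degenerates_from_C8:
  assumes "degenerates (algebra_of C8) (algebra_of T')"
  shows "T' = C8"
proof -
  have "0 * fst (algebra_of T') (e i) (e j) $ k = 1 * snd (algebra_of T') (e i) (e j) $ k" for i j k
    by (rule degenerates_coordinate_relation[OF algebra_of_bil_pairs assms])
      (simp add: vec_eq_iff table_nth)
  from this[of 1 1 1] this[of 1 1 2] this[of 2 1 1] degenerates_fst_zero[OF assms] show ?thesis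
    by (cases T') (auto simp: table_nth e_nth)
qed

section \<open>Reachability by basic degenerations\<close>

lemma reachable_C8: "T = C8 \<or> basic_degeneration\<^sup>+\<^sup>+ T C8"
proof -
  note basic = basic_degeneration.intros
  have step: "basic_degeneration\<^sup>+\<^sup>+ S C8"
    if "basic_degeneration S S'" "basic_degeneration\<^sup>+\<^sup>+ S' C8" for S S'
    using that by (rule tranclp_into_tranclp2)
  have P03: "basic_degeneration\<^sup>+\<^sup>+ P03 C8" and P09: "basic_degeneration\<^sup>+\<^sup>+ (P09 \<alpha>) C8" for \<alpha>
    by (rule tranclp.r_into_trancl, rule basic)+
  \<comment> \<open>The exceptional parameters have their own arrow to \<open>C8\<close>; the others
    pass through \<open>P03\<close>.\<close>
  have P05: "basic_degeneration\<^sup>+\<^sup>+ (P05 \<alpha>) C8" and P06: "basic_degeneration\<^sup>+\<^sup>+ (P06 \<alpha>) C8" for \<alpha>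
    using step[OF basic(12) P03, of \<alpha>] step[OF basic(13) P03, of \<alpha>] basic(15,16)
    by (cases "\<alpha> = 1"; cases "\<alpha> = 0"; simp)+
  show ?thesis
    using P03 P05 P06 P09 step[OF basic(1) P05] step[OF basic(3) P05] step[OF basic(5) P06]
      step[OF basic(8) P03] step[OF basic(10) P03] step[OF basic(11) P03]
    by (cases T) simp_all
qed

text \<open>Equality of labels, not just isomorphism, comes out, because the invariants already
  separate distinct labels and distinct parameters.\<close>

lemma degenerates_imp_reachable:
  assumes "degenerates (algebra_of T) (algebra_of T')"
  shows "T' = T \<or> basic_degeneration\<^sup>+\<^sup>+ T T'"
proof (cases "T' = C8")
  case True
  then show ?thesis using reachable_C8[of T] by auto
next
  case False
  note basic = basic_degeneration.intros
  have two: "basic_degeneration\<^sup>+\<^sup>+ S S''" if "basic_degeneration S S'" "basic_degeneration S' S''" for S S' S''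
    using that by (blast intro: tranclp_into_tranclp2)
  \<comment> \<open>These three reach \<open>P03\<close> in two steps, through \<open>P06 1\<close>
    or \<open>P06 2\<close>.\<close>
  have P03: "basic_degeneration\<^sup>+\<^sup>+ P07 P03" "basic_degeneration\<^sup>+\<^sup>+ P08 P03" "basic_degeneration\<^sup>+\<^sup>+ P10 P03"
    by (rule two[OF basic(2) basic(13)] two[OF basic(4) basic(13)] two[OF basic(5) basic(13)]; simp)+
  show ?thesis
  proof (cases T)
    case P07
    then show ?thesis using degenerates_from_P07 assms False P03 basic by auto
  next
    case P08
    then show ?thesis using degenerates_from_P08 assms False P03 basic by auto
  next
    case P10
    then show ?thesis using degenerates_from_P10 assms False P03 basic by auto
  next
    case P01
    then show ?thesis using degenerates_from_P01 assms False basic by auto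
  next
    case P02
    then show ?thesis using degenerates_from_P02 assms False basic by auto
  next
    case P03
    then show ?thesis using degenerates_from_P03 assms False by auto
  next
    case P04
    then show ?thesis using degenerates_from_P04 assms False basic by auto
  next
    case (P05 \<alpha>)
    then show ?thesis
      using degenerates_from_P05[of \<alpha> T'] degenerates_from_P05_1[of T'] assms False basic(12)[of \<alpha>] by (cases "\<alpha> = 1") auto
  next
    case (P06 \<alpha>)
    then show ?thesis
      using degenerates_from_P06[of \<alpha> T'] degenerates_from_P06_0[of T'] assms False basic(13)[of \<alpha>] by (cases "\<alpha> = 0") auto
  next
    case (P09 \<alpha>)
    then show ?thesis using degenerates_from_P09 assms False by auto
  next
    case C8
    then show ?thesis using degenerates_from_C8 assms False by auto
  qed
qed

lemma reachable_imp_degenerates: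
  "basic_degeneration\<^sup>+\<^sup>+ T T' \<Longrightarrow> degenerates (algebra_of T) (algebra_of T')"
  by (induction rule: tranclp_induct)
    (blast intro: basic_degeneration_imp_degenerates degenerates_trans algebra_of_bil_pairs)+

theorem theorem66:
  shows "(\<forall>T \<in> {P07, P08, P10}. orbit_dim (algebra_of T) = 4) \<and>
    (\<forall>T \<in> {P01, P02, P04} \<union> {P05 \<alpha> | \<alpha>. \<alpha> \<noteq> 1} \<union> {P06 \<alpha> | \<alpha>. \<alpha> \<noteq> 0}.
       orbit_dim (algebra_of T) = 3) \<and>
    (\<forall>T \<in> {P03, P05 1, P06 0} \<union> range P09. orbit_dim (algebra_of T) = 2) \<and>
    orbit_dim (algebra_of C8) = 0 \<and>
    (\<forall>T T'. degenerates (algebra_of T) (algebra_of T') \<longleftrightarrow>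
       isomorphic_alg (algebra_of T) (algebra_of T') \<or> basic_degeneration\<^sup>+\<^sup>+ T T')"
proof -
  have "degenerates (algebra_of T) (algebra_of T') \<longleftrightarrow>
      isomorphic_alg (algebra_of T) (algebra_of T') \<or> basic_degeneration\<^sup>+\<^sup>+ T T'" for T T'
    using degenerates_imp_reachable[of T T'] reachable_imp_degenerates[of T T']
      isomorphic_imp_degenerates[OF algebra_of_bil_pairs, of T "algebra_of T'"] in_orbit_self[of "algebra_of T"]
    unfolding isomorphic_alg_iff_orbit by metis
  then show ?thesis
    by (simp add: orbit_dim_algebra_of ball_Un del: algebra_of.simps)
      (auto simp: orbit_dim_algebra_of simp del: algebra_of.simps)
qed

end
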